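(* Suppose that $\mathcal E$ defines a scalar product on $\mathcal D$, and let $\mathcal D_{\mathrm e}$ be the abstract completion of $\mathcal D$ with respect to $\mathcal E[\cdot]^{1/2}$, with $\mathcal E$ extended to the Hilbert space $(\mathcal D_{\mathrm e},\mathcal E)$. Assume that $\ker J$ is $\mathcal E$-closed (i.e. closed in $(\mathcal D_{\mathrm e},\mathcal E)$), let $P$ be the $\mathcal E$-orthogonal projection in $\mathcal D_{\mathrm e}$ onto the $\mathcal E$-orthogonal complement of $\ker J$, and let $Q$ be the quadratic form in $\mathcal H_{\mathrm{aux}}$ defined by $$\operatorname{dom}Q:=\operatorname{ran}J,\qquad Q[Ju]:=\mathcal E[Pu]\quad\text{for all }u\in\operatorname{dom}J.$$ Then $\check{\mathcal E}=\overline{Q_{\mathrm{reg}}}$. Moreover, if $J\colon\operatorname{dom}J\subseteq(\mathcal D_{\mathrm e},\mathcal E)\to\mathcal H_{\mathrm{aux}}$ is closed, then $\check{\mathcal E}=Q$.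
   Context: Let $\mathcal H,\mathcal H_{\mathrm{aux}}$ be Hilbert spaces. Let $\mathcal E$ be a closed positive (i.e. symmetric, nonnegative) quadratic form with domain $\mathcal D\subseteq\mathcal H$; write $\mathcal E(\cdot,\cdot)$ for the associated sesquilinear form, $\mathcal E[u]:=\mathcal E(u,u)$, and $\mathcal E_\lambda[u]:=\mathcal E[u]+\lambda\|u\|^2$ for $\lambda>0$. Let $J\colon\operatorname{dom}J\subseteq\mathcal D\to\mathcal H_{\mathrm{aux}}$ be a linear operator with dense range which is closed as an operator from $(\mathcal D,\mathcal E_1^{1/2})$ to $\mathcal H_{\mathrm{aux}}$. For $\lambda>0$ let $P_\lambda$ be the $\mathcal E_\lambda$-orthogonal projection in the Hilbert space $(\mathcal D,\mathcal E_\lambda^{1/2})$ onto the $\mathcal E_\lambda$-orthogonal complement of $\ker J$. Define the closed positive densely defined quadratic form $\check{\mathcal E}_\lambda$ in $\mathcal H_{\mathrm{aux}}$ by $\operatorname{dom}\check{\mathcal E}_\lambda:=\operatorname{ran}J$, $\check{\mathcal E}_\lambda[Ju]:=\mathcal E_\lambda[P_\lambda u]$ for $u\in\operatorname{dom}J$, and let $\check H_\lambda$ be the associated positive self-adjoint operator. Trace form: let $\check{\mathcal E}_0$ be the form with $\operatorname{dom}\check{\mathcal E}_0=\operatorname{ran}J$, $\check{\mathcal E}_0[Ju]=\lim_{\lambda\downarrow0}\check{\mathcal E}_\lambda[Ju]$. The trace $\check{\mathcal E}$ of $\mathcal E$ with respect to $J$ is the closed form associated with the positive self-adjoint operator $\check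 H$ determined by $(\check H_\lambda+1)^{-1}\to(\check H+1)^{-1}$ strongly as $\lambda\downarrow0$; equivalently, $\check{\mathcal E}=\overline{(\check{\mathcal E}_0)_{\mathrm{reg}}}$. For a densely defined positive quadratic form $Q$ on a Hilbert space, the regular part $Q_{\mathrm{reg}}$ is the largest positive densely defined closable quadratic form (with the same domain as $Q$) dominated by $Q$; a bar denotes the closure. *)

theory Defs
  imports "HOL-Analysis.Analysis"
begin

section \<open>Hilbert spaces over the real or the complex numbers\<close>

text \<open>
  A Hilbert space carries its own field of scalars, which is either \<open>\<real>\<close> or all of \<open>\<complex>\<close>, viewed as
  a subset of the type of complex numbers. For real spaces only real inputs of \<open>scaleK\<close> matter.
  The inner product is linear in its first argument.
\<close>

class hilbert_space = banach +
  fixes scalars :: "'a itself \<Rightarrow> complex set"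
    and scaleK :: "complex \<Rightarrow> 'a \<Rightarrow> 'a"
    and ip :: "'a \<Rightarrow> 'a \<Rightarrow> complex"
  assumes scalars_cases: "scalars TYPE('a) = \<real> \<or> scalars TYPE('a) = UNIV"
    and scaleK_of_real: "scaleK (of_real r) x = r *\<^sub>R x"
    and scaleK_add_right: "c \<in> scalars TYPE('a) \<Longrightarrow> scaleK c (x + y) = scaleK c x + scaleK c y"
    and scaleK_add_left: "c \<in> scalars TYPE('a) \<Longrightarrow> d \<in> scalars TYPE('a) \<Longrightarrow>
          scaleK (c + d) x = scaleK c x + scaleK d x"
    and scaleK_mult: "c \<in> scalars TYPE('a) \<Longrightarrow> d \<in> scalars TYPE('a) \<Longrightarrow>
          scaleK (c * d) x = scaleK c (scaleK d x)"
    and ip_in_scalars: "ip x y \<in> scalars TYPE('a)"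
    and ip_add: "ip (x + y) z = ip x z + ip y z"
    and ip_scaleK: "c \<in> scalars TYPE('a) \<Longrightarrow> ip (scaleK c x) y = c * ip x y"
    and ip_commute: "ip y x = cnj (ip x y)"
    and ip_self: "ip x x = of_real ((norm x)\<^sup>2)"

instantiation real :: hilbert_space
begin
definition "scalars (_ :: real itself) = (\<real> :: complex set)"
definition "scaleK c (x::real) = Re c * x"
definition "ip x (y::real) = complex_of_real (x * y)"
instance
  by standard (auto simp: scalars_real_def scaleK_real_def ip_real_def algebra_simps
      power2_eq_square elim!: Reals_cases)
end

instantiation complex :: hilbert_space
begin
definition "scalars (_ :: complex itself) = (UNIV :: complex set)"
definition "scaleK c (x::complex) = c * x"
definition "ip x (y::complex) = x * cnj y"
instance
  by standard (auto simp: scalars_complex_def scaleK_complex_def ip_complex_def algebra_simps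
      scaleR_conv_of_real complex_norm_square simp del: of_real_power)
end

definition subspaceK :: "'a::hilbert_space set \<Rightarrow> bool" where
  "subspaceK S \<longleftrightarrow> 0 \<in> S \<and> (\<forall>x\<in>S. \<forall>y\<in>S. x + y \<in> S) \<and>
     (\<forall>c\<in>scalars TYPE('a). \<forall>x\<in>S. scaleK c x \<in> S)"


section \<open>Operators\<close>

text \<open>Possibly unbounded operators are partial functions, so that \<^const>\<open>dom\<close> and \<^const>\<open>ran\<close>
  are their domain and range.\<close>

definition linear_operator :: "('a::hilbert_space \<rightharpoonup> 'b::hilbert_space) \<Rightarrow> bool" where
  "linear_operator A \<longleftrightarrow> subspaceK (dom A) \<and>
     (\<forall>x\<in>dom A. \<forall>y\<in>dom A. the (A (x + y)) = the (A x) + the (A y)) \<and>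
     (\<forall>c\<in>scalars TYPE('a). \<forall>x\<in>dom A. the (A (scaleK c x)) = scaleK c (the (A x)))"

definition null_space :: "('a \<rightharpoonup> 'b::zero) \<Rightarrow> 'a set" where
  "null_space A = {x. A x = Some 0}"

text \<open>Meant for densely defined \<open>A\<close>, for which the vector \<open>w\<close> is unique.\<close>

definition adjoint_operator :: "('a::hilbert_space \<rightharpoonup> 'a) \<Rightarrow> ('a \<rightharpoonup> 'a)" where
  "adjoint_operator A v =
     (if \<exists>w. \<forall>u\<in>dom A. ip (the (A u)) v = ip u w
      then Some (THE w. \<forall>u\<in>dom A. ip (the (A u)) v = ip u w) else None)"

definition positive_selfadjoint :: "('a::hilbert_space \<rightharpoonup> 'a) \<Rightarrow> bool" where
  "positive_selfadjoint A \<longleftrightarrow> linear_operator A \<and> closure (dom A) = UNIV \<and>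
     adjoint_operator A = A \<and> (\<forall>u\<in>dom A. 0 \<le> Re (ip (the (A u)) u))"

text \<open>\<open>inverse_plus_one A\<close> is \<open>(A + 1)\<^sup>-\<^sup>1\<close>.\<close>

definition inverse_plus_one :: "('a::hilbert_space \<rightharpoonup> 'a) \<Rightarrow> 'a \<Rightarrow> 'a" where
  "inverse_plus_one A f = (THE u. u \<in> dom A \<and> the (A u) + u = f)"


section \<open>Quadratic forms\<close>

text \<open>A quadratic form is a partial real-valued function \<open>q\<close>, its value \<open>q[u]\<close> for \<open>u \<in> dom q\<close>
  being \<open>the (q u)\<close>.\<close>

definition symmetric_sesquilinear_on ::
    "'a::hilbert_space set \<Rightarrow> ('a \<Rightarrow> 'a \<Rightarrow> complex) \<Rightarrow> bool" where
  "symmetric_sesquilinear_on D s \<longleftrightarrow>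
     (\<forall>x\<in>D. \<forall>y\<in>D. s x y \<in> scalars TYPE('a) \<and> s y x = cnj (s x y)) \<and>
     (\<forall>x\<in>D. \<forall>y\<in>D. \<forall>z\<in>D. s (x + y) z = s x z + s y z) \<and>
     (\<forall>c\<in>scalars TYPE('a). \<forall>x\<in>D. \<forall>y\<in>D. s (scaleK c x) y = c * s x y)"

definition positive_form :: "('a::hilbert_space \<rightharpoonup> real) \<Rightarrow> bool" where
  "positive_form q \<longleftrightarrow> subspaceK (dom q) \<and>
     (\<exists>s. symmetric_sesquilinear_on (dom q) s \<and>
          (\<forall>u\<in>dom q. s u u = of_real (the (q u)) \<and> 0 \<le> the (q u)))"

text \<open>The associated sesquilinear form, given by the polarization identity.\<close>

definition polar :: "('a::hilbert_space \<rightharpoonup> real) \<Rightarrow> 'a \<Rightarrow> 'a \<Rightarrow> complex" where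
  "polar q u v =
     of_real ((the (q (u + v)) - the (q (u - v))) / 4) +
     (if scalars TYPE('a) = UNIV
      then \<i> * of_real ((the (q (u + scaleK \<i> v)) - the (q (u - scaleK \<i> v))) / 4) else 0)"

lemma polar_eq:
  fixes q :: "'a::hilbert_space \<rightharpoonup> real"
  assumes sub: "subspaceK (dom q)" and s: "symmetric_sesquilinear_on (dom q) s"
    and diag: "\<And>u. u \<in> dom q \<Longrightarrow> s u u = of_real (the (q u))"
    and u: "u \<in> dom q" and v: "v \<in> dom q"
  shows "polar q u v = s u v"
proof -
  let ?D = "dom q"
  have real_sub: "\<real> \<subseteq> scalars TYPE('a)"
    using scalars_cases[where 'a='a] by auto
  have add: "x + y \<in> ?D" if "x \<in> ?D" "y \<in> ?D" for x y
    using sub that unfolding subspaceK_def by blast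
  have m1: "- 1 \<in> scalars TYPE('a)"
    using real_sub by (meson Reals_1 Reals_minus subset_iff)
  have neg_scale: "scaleK (- 1) x = - x" for x :: 'a
    using scaleK_of_real[of "- 1" x] by simp
  have neg: "- x \<in> ?D" if "x \<in> ?D" for x
  proof -
    have "scaleK (- 1) x \<in> ?D"
      using sub that m1 unfolding subspaceK_def by blast
    then show ?thesis by (simp only: neg_scale)
  qed
  have herm: "s y x = cnj (s x y)" if "x \<in> ?D" "y \<in> ?D" for x y
    using s that unfolding symmetric_sesquilinear_on_def by blast
  have sadd: "s (x + y) z = s x z + s y z" if "x \<in> ?D" "y \<in> ?D" "z \<in> ?D" for x y z
    using s that unfolding symmetric_sesquilinear_on_def by blast
  have sscale: "s (scaleK c x) y = c * s x y"
    if "c \<in> scalars TYPE('a)" "x \<in> ?D" "y \<in> ?D" for c x y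
    using s that unfolding symmetric_sesquilinear_on_def by blast
  have sneg: "s (- x) y = - s x y" if "x \<in> ?D" "y \<in> ?D" for x y
    using sscale[OF m1 that] by (simp add: neg_scale)
  have expand: "s (x + y) (x + y) = s x x + s y y + of_real (2 * Re (s x y))"
    if "x \<in> ?D" "y \<in> ?D" for x y
  proof -
    have xy: "x + y \<in> ?D" by (rule add[OF that])
    have "s (x + y) (x + y) = s x (x + y) + s y (x + y)"
      by (rule sadd[OF that xy])
    also have "s x (x + y) = cnj (s x x + s y x)"
      using herm[OF xy that(1)] sadd[OF that that(1)] by simp
    also have "s y (x + y) = cnj (s x y + s y y)"
      using herm[OF xy that(2)] sadd[OF that that(2)] by simp
    finally show ?thesis
      using herm[OF that] herm[OF that(1) that(1)] herm[OF that(2) that(2)]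
      by (simp add: complex_eq_iff)
  qed
  have diff: "of_real (the (q (x + y)) - the (q (x - y))) = complex_of_real (4 * Re (s x y))"
    if x: "x \<in> ?D" and y: "y \<in> ?D" for x y
  proof -
    have ny: "- y \<in> ?D" by (rule neg[OF y])
    have 1: "s x (- y) = - s x y"
      using herm[OF ny x] sneg[OF y x] herm[OF y x] by simp
    have 2: "s (- y) (- y) = s y y"
      using sneg[OF y ny] herm[OF ny y] sneg[OF y y] herm[OF y y] by simp
    have "of_real (the (q (x + - y))) = s x x + s y y - of_real (2 * Re (s x y))"
      using expand[OF x ny] diag[OF add[OF x ny]] 1 2 by simp
    moreover have "of_real (the (q (x + y))) = s x x + s y y + of_real (2 * Re (s x y))"
      using expand[OF x y] diag[OF add[OF x y]] by simp
    ultimately show ?thesis by simp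
  qed
  have re: "(the (q (u + v)) - the (q (u - v))) / 4 = Re (s u v)"
    using diff[OF u v] unfolding of_real_eq_iff by simp
  show ?thesis
  proof (cases "scalars TYPE('a) = UNIV")
    case True
    then have iv: "scaleK \<i> v \<in> ?D"
      using sub v unfolding subspaceK_def by blast
    have "s u (scaleK \<i> v) = - \<i> * s u v"
      using herm[OF iv u] sscale[of \<i>, OF _ v u] herm[OF v u] True by simp
    then have "(the (q (u + scaleK \<i> v)) - the (q (u - scaleK \<i> v))) / 4 = Im (s u v)"
      using diff[OF u iv] unfolding of_real_eq_iff by simp
    then show ?thesis
      using True re by (simp add: polar_def complex_eq_iff)
  next
    case False
    then have "s u v \<in> \<real>"
      using scalars_cases[where 'a='a] s u v unfolding symmetric_sesquilinear_on_def by blast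
    then have "Im (s u v) = 0"
      by (simp add: complex_is_Real_iff)
    then show ?thesis
      using False re by (simp add: polar_def complex_eq_iff)
  qed
qed

text \<open>\<open>form_plus q \<alpha>\<close> is the form \<open>u \<mapsto> q[u] + \<alpha> \<parallel>u\<parallel>\<^sup>2\<close>.\<close>

definition form_plus :: "('a::hilbert_space \<rightharpoonup> real) \<Rightarrow> real \<Rightarrow> ('a \<rightharpoonup> real)" where
  "form_plus q \<alpha> = (\<lambda>u. map_option (\<lambda>r. r + \<alpha> * (norm u)\<^sup>2) (q u))"

definition form_Cauchy :: "('a::hilbert_space \<rightharpoonup> real) \<Rightarrow> (nat \<Rightarrow> 'a) \<Rightarrow> bool" where
  "form_Cauchy q u \<longleftrightarrow> (\<forall>n. u n \<in> dom q) \<and>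
     (\<forall>e>0. \<exists>N. \<forall>m\<ge>N. \<forall>n\<ge>N. the (q (u m - u n)) < e)"

definition form_tendsto :: "('a::hilbert_space \<rightharpoonup> real) \<Rightarrow> (nat \<Rightarrow> 'a) \<Rightarrow> 'a \<Rightarrow> bool" where
  "form_tendsto q u x \<longleftrightarrow> (\<forall>n. u n \<in> dom q) \<and> x \<in> dom q \<and> (\<lambda>n. the (q (u n - x))) \<longlonglongrightarrow> 0"

definition closed_form :: "('a::hilbert_space \<rightharpoonup> real) \<Rightarrow> bool" where
  "closed_form q \<longleftrightarrow> positive_form q \<and>
     (\<forall>u. form_Cauchy (form_plus q 1) u \<longrightarrow> (\<exists>x. form_tendsto (form_plus q 1) u x))"

definition closable_form :: "('a::hilbert_space \<rightharpoonup> real) \<Rightarrow> bool" where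
  "closable_form q \<longleftrightarrow> positive_form q \<and>
     (\<forall>u. form_Cauchy q u \<and> u \<longlonglongrightarrow> 0 \<longrightarrow> (\<lambda>n. the (q (u n))) \<longlonglongrightarrow> 0)"

text \<open>The closure of a closable form is its smallest closed extension.\<close>

definition form_closure :: "('a::hilbert_space \<rightharpoonup> real) \<Rightarrow> ('a \<rightharpoonup> real)" where
  "form_closure q = (THE c. closed_form c \<and> q \<subseteq>\<^sub>m c \<and>
     (\<forall>c'. closed_form c' \<and> q \<subseteq>\<^sub>m c' \<longrightarrow> c \<subseteq>\<^sub>m c'))"

definition closable_minorants :: "('a::hilbert_space \<rightharpoonup> real) \<Rightarrow> ('a \<rightharpoonup> real) set" where
  "closable_minorants q = {r. positive_form r \<and> closure (dom r) = UNIV \<and> closable_form r \<and>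
     dom r = dom q \<and> (\<forall>u\<in>dom q. the (r u) \<le> the (q u))}"

definition regular_part :: "('a::hilbert_space \<rightharpoonup> real) \<Rightarrow> ('a \<rightharpoonup> real)" where
  "regular_part q = (THE r. r \<in> closable_minorants q \<and>
     (\<forall>r'\<in>closable_minorants q. \<forall>u\<in>dom q. the (r' u) \<le> the (r u)))"

text \<open>The operator \<open>H\<close> associated with a closed positive densely defined form \<open>q\<close>:
  \<open>H u = w\<close> iff \<open>u \<in> dom q\<close> and \<open>q(u,v) = \<langle>w,v\<rangle>\<close> for all \<open>v \<in> dom q\<close>.\<close>

definition form_operator :: "('a::hilbert_space \<rightharpoonup> real) \<Rightarrow> ('a \<rightharpoonup> 'a)" where
  "form_operator q u =
     (if u \<in> dom q \<and> (\<exists>w. \<forall>v\<in>dom q. polar q u v = ip w v)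
      then Some (THE w. \<forall>v\<in>dom q. polar q u v = ip w v) else None)"


section \<open>Orthogonal projections and completions\<close>

text \<open>Complements and projections in the subspace \<open>D\<close> with scalar product \<open>s\<close>.\<close>

definition ortho_complement :: "('a \<Rightarrow> 'a \<Rightarrow> complex) \<Rightarrow> 'a set \<Rightarrow> 'a set \<Rightarrow> 'a set" where
  "ortho_complement s D M = {u\<in>D. \<forall>v\<in>M. s u v = 0}"

definition ortho_projection ::
    "('a \<Rightarrow> 'a \<Rightarrow> complex) \<Rightarrow> 'a::ab_group_add set \<Rightarrow> 'a set \<Rightarrow> 'a \<Rightarrow> 'a" where
  "ortho_projection s D N u = (THE p. p \<in> N \<and> u - p \<in> ortho_complement s D N)"

text \<open>The Hilbert space \<open>'c\<close>, together with the embedding \<open>\<iota>\<close> of \<open>dom q\<close>, is a completion of the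
  pre-Hilbert space \<open>(dom q, q)\<close>.\<close>

definition form_completion ::
    "('a::hilbert_space \<rightharpoonup> real) \<Rightarrow> ('a \<Rightarrow> 'c::hilbert_space) \<Rightarrow> bool" where
  "form_completion q \<iota> \<longleftrightarrow> scalars TYPE('c) = scalars TYPE('a) \<and>
     (\<forall>u\<in>dom q. \<forall>v\<in>dom q. \<iota> (u + v) = \<iota> u + \<iota> v) \<and>
     (\<forall>c\<in>scalars TYPE('a). \<forall>u\<in>dom q. \<iota> (scaleK c u) = scaleK c (\<iota> u)) \<and>
     (\<forall>u\<in>dom q. \<forall>v\<in>dom q. ip (\<iota> u) (\<iota> v) = polar q u v) \<and>
     closure (\<iota> ` dom q) = UNIV"


section \<open>Traces of forms\<close>

text \<open>Closedness of \<open>J\<close> as an operator from \<open>(dom q, q)\<close>.\<close>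

definition closed_operator_wrt ::
    "('a::hilbert_space \<rightharpoonup> real) \<Rightarrow> ('a \<rightharpoonup> 'b::hilbert_space) \<Rightarrow> bool" where
  "closed_operator_wrt q J \<longleftrightarrow>
     (\<forall>u x y. (\<forall>n. u n \<in> dom J) \<and> form_tendsto q u x \<and> (\<lambda>n. the (J (u n))) \<longlonglongrightarrow> y
        \<longrightarrow> J x = Some y)"

definition trace_projection ::
    "('a::hilbert_space \<rightharpoonup> real) \<Rightarrow> ('a \<rightharpoonup> 'b::hilbert_space) \<Rightarrow> real \<Rightarrow> 'a \<Rightarrow> 'a" where
  "trace_projection E J \<alpha> =
     (let s = polar (form_plus E \<alpha>)
      in ortho_projection s (dom E) (ortho_complement s (dom E) (null_space J)))"

text \<open>The value at \<open>J u\<close> is \<open>E\<^sub>\<alpha>[P\<^sub>\<alpha> u]\<close>; it does not depend on the choice of \<open>u\<close>, since \<open>P\<^sub>\<lambda>\<close>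
  vanishes on the kernel of \<open>J\<close>.\<close>

definition trace_approx ::
    "('a::hilbert_space \<rightharpoonup> real) \<Rightarrow> ('a \<rightharpoonup> 'b::hilbert_space) \<Rightarrow> real \<Rightarrow> ('b \<rightharpoonup> real)" where
  "trace_approx E J \<alpha> y =
     (if y \<in> ran J
      then Some (the (form_plus E \<alpha> (trace_projection E J \<alpha> (SOME u. J u = Some y)))) else None)"

definition is_trace ::
    "('a::hilbert_space \<rightharpoonup> real) \<Rightarrow> ('a \<rightharpoonup> 'b::hilbert_space) \<Rightarrow> ('b \<rightharpoonup> real) \<Rightarrow> bool" where
  "is_trace E J T \<longleftrightarrow>
     (\<exists>H. positive_selfadjoint H \<and>
        (\<forall>f. ((\<lambda>\<alpha>. inverse_plus_one (form_operator (trace_approx E J \<alpha>)) f)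
               \<longlongrightarrow> inverse_plus_one H f) (at_right 0)) \<and>
        closed_form T \<and> closure (dom T) = UNIV \<and> form_operator T = H)"

end

theory Submission
  imports Defs
begin

text \<open>
  The approximating forms and the form \<open>Q\<close> are quotients by \<open>J\<close> of one energy: their values at
  \<open>y \<in> ran J\<close> are the minima of \<open>E[u] + a \<parallel>u\<parallel>\<^sup>2\<close> and of \<open>E[u]\<close> over all \<open>u\<close> with \<open>J u = y\<close>. For
  \<open>Q\<close> this is what closedness of the kernel in the completion gives: the kernel is then complete for \<open>E\<close>,
  and \<open>P\<close> moves the embedded vectors only by embedded elements of the kernel. Hence the approximating
  forms lie above \<open>Q\<close> and tend to \<open>Q\<close> pointwise on \<open>ran J\<close> as \<open>a\<close> tends to 0
  (\<open>quotient_form_shift_limit\<close>).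

  The resolvent of a closed form at \<open>f\<close> minimizes the form plus \<open>\<parallel>v - f\<parallel>\<^sup>2\<close>, so the limit of the
  resolvents is a question about limits of minimum problems. The limit problem belongs to the lower
  semicontinuous hull of \<open>Q\<close>, here called the relaxation: minima of the approximating problems tend to
  the minimum for the relaxation, and the gap between the minima bounds the squared distance of the
  minimizers (\<open>resolvent_convergence_from_above\<close>).

  The relaxed value at \<open>x\<close> is the limit of \<open>Q\<close> along a recovery sequence \<open>u n \<longlonglongrightarrow> x\<close>. The
  parallelogram law makes recovery sequences Cauchy for \<open>Q\<close> and closed under sums. From this the
  relaxation inherits a sesquilinear form, it is closed, its restriction to \<open>dom Q\<close> is the largest
  closable minorant of \<open>Q\<close>, and \<open>dom Q\<close> is a core; so the relaxation is the closure of the regular part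
  (\<open>form_closure_regular_part\<close>). A closed form is its own relaxation, which settles the second claim
  once closedness of the graph of \<open>J\<close> is seen to make \<open>Q\<close> closed.

  A trace is unique since a closed form is determined by its resolvent
  (\<open>closed_form_eq_if_resolvent_eq\<close>).
\<close>

section \<open>Inner products and subspaces\<close>

lemma of_real_in_scalars: "complex_of_real r \<in> scalars TYPE('a::hilbert_space)"
  by (rule disjE[OF scalars_cases[where 'a='a]]) simp_all

lemma scalars_diff:
  "c \<in> scalars TYPE('a::hilbert_space) \<Longrightarrow> d \<in> scalars TYPE('a) \<Longrightarrow> c - d \<in> scalars TYPE('a)"
  by (rule disjE[OF scalars_cases[where 'a='a]]) simp_all

lemma scalars_inverse:
  "c \<in> scalars TYPE('a::hilbert_space) \<Longrightarrow> inverse c \<in> scalars TYPE('a)"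
  by (rule disjE[OF scalars_cases[where 'a='a]]) simp_all

lemma symmetric_sesquilinear_ip: "symmetric_sesquilinear_on UNIV (ip :: 'a::hilbert_space \<Rightarrow> _)"
  unfolding symmetric_sesquilinear_on_def
  by (intro conjI ballI) (rule ip_in_scalars ip_add ip_commute | erule ip_scaleK)+

lemma ip_add_right: "ip x (y + z) = ip x y + ip x (z :: 'a::hilbert_space)"
  using arg_cong[OF ip_add[of y z x], of cnj] by (simp flip: ip_commute)

lemma ip_diff: "ip (x - y) z = ip x z - ip y (z :: 'a::hilbert_space)"
  using ip_add[of "x - y" y z] by simp

lemma ip_diff_right: "ip x (y - z) = ip x y - ip x (z :: 'a::hilbert_space)"
  using ip_add_right[of x "y - z" z] by simp

lemma ip_scaleR: "ip (r *\<^sub>R x) y = of_real r * ip x (y :: 'a::hilbert_space)"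
  using ip_scaleK[OF of_real_in_scalars, of r x y] by (simp add: scaleK_of_real)

lemma ip_scaleK_right:
  "c \<in> scalars TYPE('a) \<Longrightarrow> ip x (scaleK c y) = cnj c * ip x (y :: 'a::hilbert_space)"
  using arg_cong[OF ip_scaleK[of c y x], of cnj] by (simp flip: ip_commute)

lemma norm_add_square:
  "(norm (x + y))\<^sup>2 = (norm x)\<^sup>2 + (norm y)\<^sup>2 + 2 * Re (ip x (y :: 'a::hilbert_space))"
proof -
  have "ip (x + y) (x + y) = ip x x + ip y y + (ip x y + cnj (ip x y))"
    by (simp add: ip_add ip_add_right ip_commute[of y x])
  from arg_cong[OF this, of Re] show ?thesis
    unfolding ip_self by simp
qed

lemma Re_ip_le: "Re (ip x y) \<le> norm x * norm (y :: 'a::hilbert_space)"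
proof -
  have "(norm (x + y))\<^sup>2 \<le> (norm x + norm y)\<^sup>2"
    by (simp add: norm_triangle_ineq power_mono)
  then show ?thesis by (simp add: norm_add_square power2_sum)
qed

lemma norm_scaleK:
  assumes "c \<in> scalars TYPE('a::hilbert_space)"
  shows "norm (scaleK c x) = cmod c * norm (x::'a)"
proof -
  have "ip (scaleK c x) (scaleK c x) = c * cnj c * ip x x"
    using assms by (simp add: ip_scaleK ip_scaleK_right)
  then have "complex_of_real ((norm (scaleK c x))\<^sup>2) = of_real ((cmod c * norm x)\<^sup>2)"
    unfolding ip_self by (simp add: power_mult_distrib flip: complex_norm_square)
  then have "(norm (scaleK c x))\<^sup>2 = (cmod c * norm x)\<^sup>2"
    unfolding of_real_eq_iff .
  then show ?thesis by (simp add: power2_eq_iff_nonneg)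
qed

lemma scaleK_diff_right:
  assumes "c \<in> scalars TYPE('a::hilbert_space)"
  shows "scaleK c (x - y) = scaleK c x - scaleK c (y::'a)"
  using scaleK_add_right[OF assms, of "x - y" y] by simp

lemma scaleK_inverse:
  assumes "c \<in> scalars TYPE('a::hilbert_space)" "c \<noteq> 0"
  shows "scaleK (inverse c) (scaleK c x) = (x::'a)"
  using scaleK_mult[OF scalars_inverse[OF assms(1)] assms(1), of x] assms(2) scaleK_of_real[of 1 x]
  by simp

lemma tendsto_scaleK:
  assumes c: "c \<in> scalars TYPE('a::hilbert_space)" and u: "u \<longlonglongrightarrow> (x::'a)"
  shows "(\<lambda>n. scaleK c (u n)) \<longlonglongrightarrow> scaleK c x"
proof -
  have "(\<lambda>n. cmod c * norm (u n - x)) \<longlonglongrightarrow> cmod c * norm (x - x)"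
    by (intro tendsto_intros u)
  then have "(\<lambda>n. norm (scaleK c (u n) - scaleK c x)) \<longlonglongrightarrow> 0"
    by (simp add: scaleK_diff_right[OF c, symmetric] norm_scaleK[OF c])
  then show ?thesis
    by (metis LIM_zero_iff tendsto_norm_zero_iff)
qed

lemma ip_eq_on_dense:
  assumes dense: "closure S = (UNIV :: 'a::hilbert_space set)"
    and eq: "\<And>v. v \<in> S \<Longrightarrow> ip x v = ip y v"
  shows "x = y"
proof -
  obtain v where v: "\<And>n. v n \<in> S" "v \<longlonglongrightarrow> x - y"
    using dense closure_sequential[of "x - y" S] by blast
  have le: "norm (x - y) ^ 2 \<le> norm (x - y) * norm (x - y - v n)" for n
  proof -
    have "ip (x - y) (v n) = 0" using eq[OF v(1), of n] by (simp add: ip_diff)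
    then have "Re (ip (x - y) (x - y - v n)) = norm (x - y) ^ 2"
      unfolding ip_diff_right[of _ _ "v n"] ip_self by simp
    then show ?thesis using Re_ip_le[of "x - y" "x - y - v n"] by simp
  qed
  have "(\<lambda>n. norm (x - y) * norm (x - y - v n)) \<longlonglongrightarrow> norm (x - y) * norm (x - y - (x - y))"
    by (intro tendsto_intros v)
  from LIMSEQ_le_const[OF this, of "norm (x - y) ^ 2"] le
  have "norm (x - y) ^ 2 \<le> 0" by simp
  then show ?thesis by simp
qed

lemma subspaceK_closed:
  assumes "subspaceK (S :: 'a::hilbert_space set)"
  shows "0 \<in> S" "x \<in> S \<Longrightarrow> y \<in> S \<Longrightarrow> x + y \<in> S" "x \<in> S \<Longrightarrow> y \<in> S \<Longrightarrow> x - y \<in> S"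
    "x \<in> S \<Longrightarrow> r *\<^sub>R x \<in> S" "c \<in> scalars TYPE('a) \<Longrightarrow> x \<in> S \<Longrightarrow> scaleK c x \<in> S"
proof -
  have add: "x + y \<in> S" if "x \<in> S" "y \<in> S" for x y
    using assms that unfolding subspaceK_def by blast
  have sc: "scaleK c x \<in> S" if "c \<in> scalars TYPE('a)" "x \<in> S" for c x
    using assms that unfolding subspaceK_def by blast
  have scR: "r *\<^sub>R x \<in> S" if "x \<in> S" for r x
    using sc[OF of_real_in_scalars that] by (simp add: scaleK_of_real)
  show "0 \<in> S" using assms unfolding subspaceK_def by blast
  show "x \<in> S \<Longrightarrow> y \<in> S \<Longrightarrow> x + y \<in> S" by (rule add)
  show "x \<in> S \<Longrightarrow> y \<in> S \<Longrightarrow> x - y \<in> S" using add[of x "-1 *\<^sub>R y"] scR[of y "-1"] by simp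
  show "x \<in> S \<Longrightarrow> r *\<^sub>R x \<in> S" by (rule scR)
  show "c \<in> scalars TYPE('a) \<Longrightarrow> x \<in> S \<Longrightarrow> scaleK c x \<in> S" by (rule sc)
qed

text \<open>Variational arguments only control real parts. Inserting \<open>\<i> v\<close> recovers the imaginary part over
  the complex scalars, while over the real ones there is none.\<close>

lemma antilinear_zero_if_Re_zero:
  assumes D: "subspaceK (D :: 'a::hilbert_space set)"
    and sc: "\<And>v. v \<in> D \<Longrightarrow> \<phi> v \<in> scalars TYPE('a)"
    and hom: "\<And>c v. c \<in> scalars TYPE('a) \<Longrightarrow> v \<in> D \<Longrightarrow> \<phi> (scaleK c v) = cnj c * \<phi> v"
    and Re0: "\<And>v. v \<in> D \<Longrightarrow> Re (\<phi> v) = 0" and v: "v \<in> D"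
  shows "\<phi> v = 0"
proof (cases "scalars TYPE('a) = UNIV")
  case True
  have "Re (\<phi> (scaleK \<i> v)) = 0"
    using Re0 subspaceK_closed(5)[OF D _ v] True by simp
  then show ?thesis
    using hom[of \<i> v] v Re0[OF v] True by (simp add: complex_eq_iff)
next
  case False
  then have "\<phi> v \<in> \<real>" using scalars_cases[where 'a='a] sc[OF v] by auto
  then show ?thesis using Re0[OF v] by (simp add: complex_eq_iff complex_is_Real_iff)
qed


section \<open>Positive quadratic forms\<close>

lemma dom_form_plus [simp]: "dom (form_plus q a) = dom q"
  unfolding form_plus_def dom_def by auto

lemma the_form_plus: "u \<in> dom q \<Longrightarrow> the (form_plus q a u) = the (q u) + a * (norm u)\<^sup>2"
  unfolding form_plus_def by auto

lemma polar_in_scalars: "polar q (u :: 'a::hilbert_space) v \<in> scalars TYPE('a)"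
proof (cases "scalars TYPE('a) = UNIV")
  case False
  then have "polar q u v = of_real ((the (q (u + v)) - the (q (u - v))) / 4)"
    unfolding polar_def by simp
  then show ?thesis by (simp only: of_real_in_scalars)
qed simp

lemma discriminant_le:
  fixes a b c :: real
  assumes nn: "\<And>t. 0 \<le> a + t\<^sup>2 * c + 2 * (t * b)" and "0 \<le> c"
  shows "b\<^sup>2 \<le> a * c"
proof (cases "c = 0")
  case True
  have "b = 0"
  proof (rule ccontr)
    assume "b \<noteq> 0"
    then show False using nn[of "- (a + 1) / (2 * b)"] nn[of 0] True
      by (simp add: field_simps)
  qed
  then show ?thesis using True by simp
next
  case False
  then have "0 < c" using assms by simp
  then show ?thesis using nn[of "- b / c"]
    by (simp add: field_simps power2_eq_square)
qed

context
  fixes q :: "'a::hilbert_space \<rightharpoonup> real"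
  assumes pos: "positive_form q"
begin

lemma dom_subspace: "subspaceK (dom q)"
  using pos unfolding positive_form_def by blast

lemmas dom_form_closed = subspaceK_closed[OF dom_subspace]

lemma form_nonneg: "u \<in> dom q \<Longrightarrow> 0 \<le> the (q u)"
  using pos unfolding positive_form_def by blast

lemma polar_sesquilinear: "symmetric_sesquilinear_on (dom q) (polar q)"
  and polar_self: "u \<in> dom q \<Longrightarrow> polar q u u = of_real (the (q u))"
proof -
  obtain s where s: "symmetric_sesquilinear_on (dom q) s"
    and d: "\<And>u. u \<in> dom q \<Longrightarrow> s u u = of_real (the (q u))"
    using pos unfolding positive_form_def by blast
  have eq: "polar q u v = s u v" if "u \<in> dom q" "v \<in> dom q" for u v
    by (rule polar_eq[OF dom_subspace s d that])
  show "symmetric_sesquilinear_on (dom q) (polar q)"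
    unfolding symmetric_sesquilinear_on_def
  proof (intro conjI ballI)
    fix x y z c assume d: "x \<in> dom q" "y \<in> dom q"
    show "polar q x y \<in> scalars TYPE('a)" "polar q y x = cnj (polar q x y)"
      unfolding eq[OF d] eq[OF d(2,1)]
      using s d unfolding symmetric_sesquilinear_on_def by blast+
    show "polar q (x + y) z = polar q x z + polar q y z" if z: "z \<in> dom q"
      unfolding eq[OF dom_form_closed(2)[OF d] z] eq[OF d(1) z] eq[OF d(2) z]
      using s d z unfolding symmetric_sesquilinear_on_def by blast
    show "polar q (scaleK c x) y = c * polar q x y" if c: "c \<in> scalars TYPE('a)"
      unfolding eq[OF dom_form_closed(5)[OF c d(1)] d(2)] eq[OF d]
      using s d c unfolding symmetric_sesquilinear_on_def by blast
  qed
  show "u \<in> dom q \<Longrightarrow> polar q u u = of_real (the (q u))"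
    by (simp add: eq d)
qed

lemma polar_commute: "u \<in> dom q \<Longrightarrow> v \<in> dom q \<Longrightarrow> polar q v u = cnj (polar q u v)"
  and polar_add: "u \<in> dom q \<Longrightarrow> v \<in> dom q \<Longrightarrow> w \<in> dom q \<Longrightarrow>
    polar q (u + v) w = polar q u w + polar q v w"
  and polar_scaleK: "c \<in> scalars TYPE('a) \<Longrightarrow> u \<in> dom q \<Longrightarrow> v \<in> dom q \<Longrightarrow>
    polar q (scaleK c u) v = c * polar q u v"
  using polar_sesquilinear unfolding symmetric_sesquilinear_on_def by blast+

lemma polar_diff:
  assumes "u \<in> dom q" "v \<in> dom q" "w \<in> dom q"
  shows "polar q (u - v) w = polar q u w - polar q v w"
  using polar_add[OF dom_form_closed(3)[OF assms(1,2)] assms(2,3)] by simp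

lemma polar_add_right:
  assumes "u \<in> dom q" "v \<in> dom q" "w \<in> dom q"
  shows "polar q w (u + v) = polar q w u + polar q w v"
  using assms by (simp add: polar_commute[of _ w] polar_add dom_form_closed)

lemma polar_scaleK_right:
  assumes "c \<in> scalars TYPE('a)" "u \<in> dom q" "v \<in> dom q"
  shows "polar q v (scaleK c u) = cnj c * polar q v u"
  using assms by (simp add: polar_commute[of _ v] polar_scaleK dom_form_closed)

lemma Re_polar_scaleR_right:
  assumes "u \<in> dom q" "v \<in> dom q"
  shows "Re (polar q v (r *\<^sub>R u)) = r * Re (polar q v u)"
  using polar_scaleK_right[OF of_real_in_scalars assms, of r] by (simp add: scaleK_of_real)

lemma form_scaleK:
  assumes "c \<in> scalars TYPE('a)" "u \<in> dom q"
  shows "the (q (scaleK c u)) = (cmod c)\<^sup>2 * the (q u)"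
proof -
  have "complex_of_real (the (q (scaleK c u))) = c * cnj c * of_real (the (q u))"
    using assms by (simp flip: polar_self add: dom_form_closed polar_scaleK polar_scaleK_right)
  also have "\<dots> = of_real ((cmod c)\<^sup>2 * the (q u))"
    unfolding of_real_mult complex_norm_square ..
  finally show ?thesis unfolding of_real_eq_iff .
qed

lemma form_scaleR: "u \<in> dom q \<Longrightarrow> the (q (r *\<^sub>R u)) = r\<^sup>2 * the (q u)"
  using form_scaleK[OF of_real_in_scalars, of u r] by (simp add: scaleK_of_real)

lemma form_zero: "the (q 0) = 0"
  using form_scaleR[OF dom_form_closed(1), of 0] by simp

lemma form_add:
  assumes "u \<in> dom q" "v \<in> dom q"
  shows "the (q (u + v)) = the (q u) + the (q v) + 2 * Re (polar q u v)"
proof -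
  have "complex_of_real (the (q (u + v)))
      = of_real (the (q u)) + of_real (the (q v)) + (polar q u v + cnj (polar q u v))"
    using assms polar_commute[OF assms]
    by (simp flip: polar_self add: dom_form_closed polar_add polar_add_right)
  then have "Re (complex_of_real (the (q (u + v))))
      = Re (of_real (the (q u)) + of_real (the (q v)) + (polar q u v + cnj (polar q u v)))"
    by simp
  then show ?thesis by simp
qed

lemma form_diff:
  assumes "u \<in> dom q" "v \<in> dom q"
  shows "the (q (u - v)) = the (q u) + the (q v) - 2 * Re (polar q u v)"
  using form_add[OF assms(1) dom_form_closed(4)[OF assms(2)], of "-1"]
    form_scaleR[OF assms(2), of "-1"] Re_polar_scaleR_right[OF assms(2,1), of "-1"]
  by simp

lemma parallelogram:
  assumes "u \<in> dom q" "v \<in> dom q"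
  shows "the (q (u + v)) + the (q (u - v)) = 2 * the (q u) + 2 * the (q v)"
  using assms by (simp add: form_add form_diff)

lemma form_diff_midpoint:
  assumes "u \<in> dom q" "v \<in> dom q"
  shows "the (q (u - v)) = 2 * the (q u) + 2 * the (q v) - 4 * the (q ((1/2) *\<^sub>R (u + v)))"
  using parallelogram[OF assms] assms
  by (simp add: form_scaleR dom_form_closed power2_eq_square)

lemma polar_Cauchy_Schwarz:
  assumes "u \<in> dom q" "v \<in> dom q"
  shows "(Re (polar q u v))\<^sup>2 \<le> the (q u) * the (q v)"
proof (rule discriminant_le)
  show "0 \<le> the (q u) + t\<^sup>2 * the (q v) + 2 * (t * Re (polar q u v))" for t
    using form_nonneg[OF dom_form_closed(2)[OF assms(1) dom_form_closed(4)[OF assms(2)]], of t] assms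
    by (simp add: form_add form_scaleR dom_form_closed Re_polar_scaleR_right)
qed (rule form_nonneg[OF assms(2)])

lemma form_plus_positive:
  assumes "0 \<le> a"
  shows "positive_form (form_plus q a)"
  unfolding positive_form_def
proof (intro conjI exI[of _ "\<lambda>u v. polar q u v + of_real a * ip u v"] ballI)
  show "subspaceK (dom (form_plus q a))" by (simp add: dom_subspace)
  have sc: "x + of_real a * y \<in> scalars TYPE('a)"
    if "x \<in> scalars TYPE('a)" "y \<in> scalars TYPE('a)" for x y
    using that by (rule_tac disjE[OF scalars_cases[where 'a='a]]) simp_all
  show "symmetric_sesquilinear_on (dom (form_plus q a)) (\<lambda>u v. polar q u v + of_real a * ip u v)"
    unfolding symmetric_sesquilinear_on_def dom_form_plus
  proof (intro conjI ballI)
    fix x y z c assume d: "x \<in> dom q" "y \<in> dom q"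
    show "polar q x y + of_real a * ip x y \<in> scalars TYPE('a)"
      by (intro sc polar_in_scalars ip_in_scalars)
    show "polar q y x + of_real a * ip y x = cnj (polar q x y + of_real a * ip x y)"
      using polar_commute[OF d] ip_commute[of y x] by simp
    show "polar q (x + y) z + of_real a * ip (x + y) z
        = polar q x z + of_real a * ip x z + (polar q y z + of_real a * ip y z)" if "z \<in> dom q"
      using polar_add[OF d that] by (simp add: ip_add algebra_simps)
    show "polar q (scaleK c x) y + of_real a * ip (scaleK c x) y
        = c * (polar q x y + of_real a * ip x y)" if "c \<in> scalars TYPE('a)"
      using polar_scaleK[OF that d] that by (simp add: ip_scaleK algebra_simps)
  qed
  fix u assume u: "u \<in> dom (form_plus q a)"
  show "polar q u u + of_real a * ip u u = of_real (the (form_plus q a u))"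
    using u by (simp add: polar_self ip_self the_form_plus)
  show "0 \<le> the (form_plus q a u)"
    using u assms by (simp add: the_form_plus form_nonneg)
qed

lemma polar_form_plus:
  assumes "0 \<le> a" "u \<in> dom q" "v \<in> dom q"
  shows "Re (polar (form_plus q a) u v) = Re (polar q u v) + a * Re (ip u v)"
proof -
  have n: "(norm (u - v))\<^sup>2 = (norm u)\<^sup>2 + (norm v)\<^sup>2 - 2 * Re (ip u v)"
    using norm_add_square[of "u - v" v] by (simp add: ip_diff ip_self)
  show ?thesis
    using assms unfolding polar_def[of "form_plus q a"]
    by (simp add: the_form_plus dom_form_closed form_add form_diff norm_add_square n field_simps)
qed

lemma form_tendsto_polar:
  assumes "form_tendsto q u x" "v \<in> dom q"
  shows "(\<lambda>n. Re (polar q (u n) v)) \<longlonglongrightarrow> Re (polar q x v)"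
proof -
  have d: "\<And>n. u n \<in> dom q" "x \<in> dom q" and l: "(\<lambda>n. the (q (u n - x))) \<longlonglongrightarrow> 0"
    using assms unfolding form_tendsto_def by auto
  have "(\<lambda>n. Re (polar q (u n - x) v)) \<longlonglongrightarrow> 0"
  proof (rule Lim_null_comparison)
    show "\<forall>\<^sub>F n in sequentially.
      norm (Re (polar q (u n - x) v)) \<le> sqrt (the (q (u n - x)) * the (q v))"
    proof (intro always_eventually allI)
      fix n
      show "norm (Re (polar q (u n - x) v)) \<le> sqrt (the (q (u n - x)) * the (q v))"
        using polar_Cauchy_Schwarz[OF dom_form_closed(3)[OF d] assms(2), of n]
        by (intro real_le_rsqrt) simp
    qed
    have "(\<lambda>n. sqrt (the (q (u n - x)) * the (q v))) \<longlonglongrightarrow> sqrt (0 * the (q v))"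
      by (intro tendsto_intros l)
    then show "(\<lambda>n. sqrt (the (q (u n - x)) * the (q v))) \<longlonglongrightarrow> 0" by simp
  qed
  then have "(\<lambda>n. Re (polar q (u n) v) - Re (polar q x v)) \<longlonglongrightarrow> 0"
    using d assms(2) by (simp add: polar_diff)
  then show ?thesis by (rule LIM_zero_cancel)
qed

lemma form_tendsto_value:
  assumes "form_tendsto q u x"
  shows "(\<lambda>n. the (q (u n))) \<longlonglongrightarrow> the (q x)"
proof -
  have d: "\<And>n. u n \<in> dom q" "x \<in> dom q" and l: "(\<lambda>n. the (q (u n - x))) \<longlonglongrightarrow> 0"
    using assms unfolding form_tendsto_def by auto
  have "(\<lambda>n. the (q (u n - x)) + 2 * Re (polar q (u n) x) - the (q x))
      \<longlonglongrightarrow> 0 + 2 * Re (polar q x x) - the (q x)"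
    by (intro tendsto_intros l form_tendsto_polar[OF assms] d)
  moreover have "the (q (u n)) = the (q (u n - x)) + 2 * Re (polar q (u n) x) - the (q x)" for n
    using form_diff[OF d, of n] by simp
  ultimately show ?thesis using d by (simp add: polar_self)
qed

lemma form_Cauchy_plus:
  assumes a: "0 < a"
  shows "form_Cauchy (form_plus q a) u \<longleftrightarrow> form_Cauchy q u \<and> Cauchy u"
proof (cases "\<forall>n. u n \<in> dom q")
  case True
  then have d: "u m - u n \<in> dom q" for m n by (simp add: dom_form_closed)
  note val = the_form_plus[OF d] and nn = form_nonneg[OF d]
  show ?thesis
  proof
    assume L: "form_Cauchy (form_plus q a) u"
    have "\<exists>N. \<forall>m\<ge>N. \<forall>n\<ge>N. the (q (u m - u n)) < e \<and> a * (norm (u m - u n))\<^sup>2 < e" if e: "0 < e" for e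
    proof -
      obtain N where N: "\<And>m n. m \<ge> N \<Longrightarrow> n \<ge> N \<Longrightarrow> the (q (u m - u n)) + a * (norm (u m - u n))\<^sup>2 < e"
        using L e unfolding form_Cauchy_def val by blast
      have "0 \<le> a * (norm (u m - u n))\<^sup>2" for m n using a by simp
      then show ?thesis using N nn by (smt (verit))
    qed note key = this
    have "Cauchy u"
    proof (rule CauchyI)
      fix e :: real assume e: "0 < e"
      then obtain N where "\<And>m n. m \<ge> N \<Longrightarrow> n \<ge> N \<Longrightarrow> a * (norm (u m - u n))\<^sup>2 < a * e\<^sup>2"
        using key[of "a * e\<^sup>2"] a by auto
      then show "\<exists>N. \<forall>m\<ge>N. \<forall>n\<ge>N. norm (u m - u n) < e"
        using a e by (auto intro!: exI[of _ N] intro: power2_less_imp_less)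
    qed
    moreover have "form_Cauchy q u"
      unfolding form_Cauchy_def using True key by meson
    ultimately show "form_Cauchy q u \<and> Cauchy u" by blast
  next
    assume R: "form_Cauchy q u \<and> Cauchy u"
    show "form_Cauchy (form_plus q a) u"
      unfolding form_Cauchy_def val dom_form_plus
    proof (intro conjI allI impI)
      show "u n \<in> dom q" for n using True by blast
      fix e :: real assume e: "0 < e"
      obtain N where N: "\<And>m n. m \<ge> N \<Longrightarrow> n \<ge> N \<Longrightarrow> the (q (u m - u n)) < e / 2"
        using R e unfolding form_Cauchy_def by (meson half_gt_zero)
      have "0 < sqrt (e / (2 * a))" using a e by simp
      then obtain M where M: "\<And>m n. m \<ge> M \<Longrightarrow> n \<ge> M \<Longrightarrow> norm (u m - u n) < sqrt (e / (2 * a))"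
        using R CauchyD by meson
      have "a * (norm (u m - u n))\<^sup>2 < e / 2" if "m \<ge> M" "n \<ge> M" for m n
      proof -
        have "(norm (u m - u n))\<^sup>2 < (sqrt (e / (2 * a)))\<^sup>2"
          using M[OF that] by (simp add: power_strict_mono)
        then show ?thesis using a e by (simp add: field_simps)
      qed
      then show "\<exists>N. \<forall>m\<ge>N. \<forall>n\<ge>N. the (q (u m - u n)) + a * (norm (u m - u n))\<^sup>2 < e"
        using N by (intro exI[of _ "max M N"]) (metis add_strict_mono field_sum_of_halves max.bounded_iff)
    qed
  qed
qed (auto simp: form_Cauchy_def)

lemma form_tendsto_plus:
  assumes a: "0 < a"
  shows "form_tendsto (form_plus q a) u x \<longleftrightarrow> form_tendsto q u x \<and> u \<longlonglongrightarrow> x"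
proof (cases "(\<forall>n. u n \<in> dom q) \<and> x \<in> dom q")
  case True
  then have d: "u n - x \<in> dom q" for n by (simp add: dom_form_closed)
  note val = the_form_plus[OF d] and nn = form_nonneg[OF d]
  have "(\<lambda>n. the (q (u n - x)) + a * (norm (u n - x))\<^sup>2) \<longlonglongrightarrow> 0 \<longleftrightarrow>
      (\<lambda>n. the (q (u n - x))) \<longlonglongrightarrow> 0 \<and> u \<longlonglongrightarrow> x" (is "?L \<longlonglongrightarrow> 0 \<longleftrightarrow> _")
  proof
    assume L: "?L \<longlonglongrightarrow> 0"
    have "(\<lambda>n. the (q (u n - x))) \<longlonglongrightarrow> 0"
      by (rule Lim_null_comparison[OF _ L]) (use nn a in simp)
    moreover have "(\<lambda>n. norm (u n - x)) \<longlonglongrightarrow> 0"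
    proof -
      have "(\<lambda>n. a * (norm (u n - x))\<^sup>2) \<longlonglongrightarrow> 0"
        by (rule Lim_null_comparison[OF _ L]) (use nn a in simp)
      then have "(\<lambda>n. (1 / a) * (a * (norm (u n - x))\<^sup>2)) \<longlonglongrightarrow> (1 / a) * 0"
        by (intro tendsto_intros)
      then have "(\<lambda>n. sqrt ((norm (u n - x))\<^sup>2)) \<longlonglongrightarrow> sqrt 0"
        using a by (intro tendsto_intros) simp
      then show ?thesis by simp
    qed
    ultimately show "(\<lambda>n. the (q (u n - x))) \<longlonglongrightarrow> 0 \<and> u \<longlonglongrightarrow> x"
      using tendsto_norm_zero_iff LIM_zero_iff by blast
  next
    assume R: "(\<lambda>n. the (q (u n - x))) \<longlonglongrightarrow> 0 \<and> u \<longlonglongrightarrow> x"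
    then have "?L \<longlonglongrightarrow> 0 + a * (norm (x - x))\<^sup>2"
      by (intro tendsto_intros) auto
    then show "?L \<longlonglongrightarrow> 0" by simp
  qed
  then show ?thesis
    using True unfolding form_tendsto_def val by simp
qed (auto simp: form_tendsto_def)

end

lemma positive_if_closed: "closed_form c \<Longrightarrow> positive_form c"
  unfolding closed_form_def by blast

text \<open>A positive shift of the form contributes to form convergence only convergence in norm, so
  completeness can be used without fixing the size of the shift.\<close>

lemma closed_form_complete:
  assumes c: "closed_form c" and "form_Cauchy c u" "Cauchy u"
  obtains x where "form_tendsto c u x" "u \<longlonglongrightarrow> x"
proof -
  have pos: "positive_form c" and
    compl: "form_Cauchy (form_plus c 1) u \<longrightarrow> (\<exists>x. form_tendsto (form_plus c 1) u x)"
    using c unfolding closed_form_def by blast+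
  then show ?thesis
    using that assms form_Cauchy_plus[OF pos, of 1] form_tendsto_plus[OF pos, of 1] by auto
qed


section \<open>Riesz representation and orthogonal decomposition\<close>

text \<open>The functional \<open>p[v] - 2 \<phi> v\<close> is bounded below on \<open>N\<close>. A minimizing sequence is Cauchy because
  midpoints cannot lie below the infimum, and its limit satisfies the Euler equation. Working with real
  linear functionals treats real and complex scalars alike.\<close>

lemma riesz_representation:
  fixes p :: "'a::hilbert_space \<rightharpoonup> real"
  assumes pos: "positive_form p" and N: "subspaceK N" "N \<subseteq> dom p"
    and complete: "\<And>u. (\<forall>n. u n \<in> N) \<Longrightarrow> form_Cauchy p u \<Longrightarrow> \<exists>x\<in>N. form_tendsto p u x"
    and add: "\<And>u v. u \<in> N \<Longrightarrow> v \<in> N \<Longrightarrow> \<phi> (u + v) = \<phi> u + \<phi> v"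
    and scale: "\<And>r u. u \<in> N \<Longrightarrow> \<phi> (r *\<^sub>R u) = r * \<phi> u"
    and C: "0 \<le> C" and bound: "\<And>u. u \<in> N \<Longrightarrow> (\<phi> u)\<^sup>2 \<le> C * the (p u)"
  shows "\<exists>x\<in>N. \<forall>v\<in>N. Re (polar p x v) = \<phi> v"
proof -
  define F where "F v = the (p v) - 2 * \<phi> v" for v
  note cl = subspaceK_closed[OF N(1)]
  have D: "u \<in> dom p" if "u \<in> N" for u using N(2) that by blast
  have "- C \<le> F v" if v: "v \<in> N" for v
  proof -
    have "(2 * \<phi> v)\<^sup>2 \<le> 4 * (C * the (p v))" using bound[OF v] by (simp add: power_mult_distrib)
    also have "\<dots> \<le> (C + the (p v))\<^sup>2"
      using zero_le_power2[of "C - the (p v)"] by (simp add: power2_sum power2_diff)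
    finally have "2 * \<phi> v \<le> C + the (p v)"
      by (rule power2_le_imp_le) (simp add: C form_nonneg[OF pos D[OF v]])
    then show ?thesis unfolding F_def by simp
  qed
  then have bdd: "bdd_below (F ` N)" by (intro bdd_belowI2)
  define m where "m = Inf (F ` N)"
  have m_le: "m \<le> F v" if "v \<in> N" for v
    unfolding m_def by (rule cInf_lower[OF _ bdd]) (use that in blast)
  have ex: "\<exists>v\<in>N. F v < m + 1 / real (Suc n)" for n
  proof -
    have "m < m + 1 / real (Suc n)" by simp
    then show ?thesis using cl(1) unfolding m_def
      by (subst (asm) cInf_less_iff[OF _ bdd]) auto
  qed
  obtain u where u: "\<And>n. u n \<in> N" and Fu: "\<And>n. F (u n) < m + 1 / real (Suc n)"
    using ex by metis
  have "the (p (u i - u j)) < e"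
    if "0 < e" "4 / e \<le> real i" "4 / e \<le> real j" for e i j
  proof -
    have mid: "m \<le> F ((1/2) *\<^sub>R (u i + u j))" by (intro m_le cl u)
    have "the (p (u i - u j)) = 2 * F (u i) + 2 * F (u j) - 4 * F ((1/2) *\<^sub>R (u i + u j))"
      unfolding F_def form_diff_midpoint[OF pos D[OF u] D[OF u]]
        scale[OF cl(2)[OF u u]] add[OF u u] by algebra
    moreover have "1 / real (Suc i) \<le> e / 4" "1 / real (Suc j) \<le> e / 4"
      using that by (auto simp: field_simps)
    ultimately show ?thesis using mid Fu[of i] Fu[of j] by linarith
  qed
  moreover have "\<exists>N. 4 / e \<le> real N" for e by (rule real_arch_simple)
  ultimately have "form_Cauchy p u"
    unfolding form_Cauchy_def using D[OF u] by (meson of_nat_mono order_trans)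
  then obtain x where x: "x \<in> N" "form_tendsto p u x" using complete u by blast
  have "Re (polar p x v) = \<phi> v" if v: "v \<in> N" for v
  proof -
    \<comment> \<open>Moving from \<open>u n\<close> in the direction \<open>v\<close> gains less than \<open>1 / (n + 1)\<close>, which bounds the slope.\<close>
    have sq: "(Re (polar p (u n) v) - \<phi> v)\<^sup>2 \<le> 1 / real (Suc n) * the (p v)" for n
    proof (rule discriminant_le)
      fix t
      have "m \<le> F (u n + t *\<^sub>R v)" by (intro m_le cl u v)
      also have "\<dots> = F (u n) + t\<^sup>2 * the (p v) + 2 * (t * (Re (polar p (u n) v) - \<phi> v))"
        unfolding F_def using form_add[OF pos D[OF u] D[OF cl(4)[OF v]], of n t]
        by (simp add: form_scaleR[OF pos D[OF v]] Re_polar_scaleR_right[OF pos D[OF v] D[OF u]]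
            add[OF u cl(4)[OF v]] scale[OF v] algebra_simps)
      finally show "0 \<le> 1 / real (Suc n) + t\<^sup>2 * the (p v) + 2 * (t * (Re (polar p (u n) v) - \<phi> v))"
        using Fu[of n] by simp
    qed (rule form_nonneg[OF pos D[OF v]])
    have "(\<lambda>n. (Re (polar p (u n) v) - \<phi> v)\<^sup>2) \<longlonglongrightarrow> (Re (polar p x v) - \<phi> v)\<^sup>2"
      by (intro tendsto_intros form_tendsto_polar[OF pos x(2) D[OF v]])
    moreover have "(\<lambda>n. 1 / real (Suc n) * the (p v)) \<longlonglongrightarrow> 0 * the (p v)"
      by (intro tendsto_intros LIMSEQ_Suc[OF lim_1_over_n])
    ultimately have "(Re (polar p x v) - \<phi> v)\<^sup>2 \<le> 0 * the (p v)"
      by (rule LIMSEQ_le) (use sq in blast)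
    then show ?thesis by simp
  qed
  then show ?thesis using x by blast
qed

lemma orthogonal_decomposition:
  fixes p :: "'a::hilbert_space \<rightharpoonup> real"
  assumes pos: "positive_form p" and N: "subspaceK N" "N \<subseteq> dom p"
    and complete: "\<And>u. (\<forall>n. u n \<in> N) \<Longrightarrow> form_Cauchy p u \<Longrightarrow> \<exists>x\<in>N. form_tendsto p u x"
    and u: "u \<in> dom p"
  shows "\<exists>k\<in>N. \<forall>v\<in>N. polar p (u - k) v = 0"
proof -
  have D: "v \<in> dom p" if "v \<in> N" for v using N(2) that by blast
  have "\<exists>k\<in>N. \<forall>v\<in>N. Re (polar p k v) = Re (polar p u v)"
  proof (rule riesz_representation[OF pos N complete])
    show "0 \<le> the (p u)" by (rule form_nonneg[OF pos u])
    show "(Re (polar p u v))\<^sup>2 \<le> the (p u) * the (p v)" if "v \<in> N" for v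
      by (rule polar_Cauchy_Schwarz[OF pos u D[OF that]])
  qed (simp_all add: polar_add_right[OF pos] Re_polar_scaleR_right[OF pos] u D)
  then obtain k where k: "k \<in> N" "\<And>v. v \<in> N \<Longrightarrow> Re (polar p k v) = Re (polar p u v)" by blast
  have uk: "u - k \<in> dom p" by (rule dom_form_closed(3)[OF pos u D[OF k(1)]])
  have "polar p (u - k) v = 0" if "v \<in> N" for v
  proof (rule antilinear_zero_if_Re_zero[OF N(1) polar_in_scalars _ _ that])
    show "polar p (u - k) (scaleK c v) = cnj c * polar p (u - k) v"
      if "c \<in> scalars TYPE('a)" "v \<in> N" for c v
      by (rule polar_scaleK_right[OF pos that(1) D[OF that(2)] uk])
    show "Re (polar p (u - k) v) = 0" if "v \<in> N" for v
      using k(2)[OF that] by (simp add: polar_diff[OF pos u D[OF k(1)] D[OF that]])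
  qed
  then show ?thesis using k(1) by blast
qed

text \<open>Projecting onto the complement of \<open>M\<close> removes an element \<open>k\<close> of \<open>M\<close> itself, not merely one of the
  double complement, as soon as some \<open>u - k\<close> is orthogonal to \<open>M\<close>.\<close>

lemma ortho_projection_eq:
  fixes D :: "'a::hilbert_space set"
  assumes s: "symmetric_sesquilinear_on D s" and D: "subspaceK D"
    and definite: "\<And>x. x \<in> D \<Longrightarrow> s x x = 0 \<Longrightarrow> x = 0"
    and M: "k \<in> M" "M \<subseteq> D" and u: "u \<in> D"
    and ortho: "\<And>v. v \<in> M \<Longrightarrow> s (u - k) v = 0"
  shows "ortho_projection s D (ortho_complement s D M) u = u - k"
  unfolding ortho_projection_def
proof (rule the_equality)
  note cl = subspaceK_closed[OF D]
  have kD: "k \<in> D" using M by blast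
  have comm: "s y x = cnj (s x y)" if "x \<in> D" "y \<in> D" for x y
    using s that unfolding symmetric_sesquilinear_on_def by blast
  have add: "s (x + y) z = s x z + s y z" if "x \<in> D" "y \<in> D" "z \<in> D" for x y z
    using s that unfolding symmetric_sesquilinear_on_def by blast
  have diff: "s (x - y) z = s x z - s y z" if "x \<in> D" "y \<in> D" "z \<in> D" for x y z
    using add[of "x - y" y z] that cl by simp
  have "s k v = 0" if "v \<in> ortho_complement s D M" for v
    using comm[of v k] that M kD unfolding ortho_complement_def by auto
  then show in_N: "u - k \<in> ortho_complement s D M \<and>
      u - (u - k) \<in> ortho_complement s D (ortho_complement s D M)"
    using ortho u kD cl unfolding ortho_complement_def by auto
  fix x assume x: "x \<in> ortho_complement s D M \<and>
      u - x \<in> ortho_complement s D (ortho_complement s D M)"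
  let ?y = "x - (u - k)"
  have mem: "x \<in> D" "u - k \<in> D" "u - x \<in> D" "?y \<in> D"
    using x in_N u cl unfolding ortho_complement_def by auto
  have y: "?y \<in> ortho_complement s D M"
    using x in_N mem M unfolding ortho_complement_def by (auto simp: diff subset_iff)
  have "s (u - (u - k)) ?y = 0" "s (u - x) ?y = 0"
    using y x in_N unfolding ortho_complement_def by blast+
  moreover have "s ((u - (u - k)) - (u - x)) ?y = s (u - (u - k)) ?y - s (u - x) ?y"
    using mem kD by (intro diff) simp_all
  moreover have y_eq: "(u - (u - k)) - (u - x) = ?y" by (simp add: algebra_simps)
  ultimately have "s ?y ?y = 0" unfolding y_eq by simp
  then show "x = u - k" using definite[OF mem(4)] by simp
qed


section \<open>The lower semicontinuous relaxation of a form\<close>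

text \<open>The bounds \<open>c\<close> at \<open>x\<close> are the values that are at least the lower limit of \<open>q\<close> at \<open>x\<close>, where \<open>q\<close>
  counts as infinite outside its domain. The relaxation is thus the lower semicontinuous hull of \<open>q\<close>,
  with the points of finite value as its domain.\<close>

definition relaxed_bound :: "('a::hilbert_space \<rightharpoonup> real) \<Rightarrow> 'a \<Rightarrow> real \<Rightarrow> bool" where
  "relaxed_bound q x c \<longleftrightarrow> (\<forall>e>0. \<exists>v\<in>dom q. norm (v - x) < e \<and> the (q v) < c + e)"

definition relaxation :: "('a::hilbert_space \<rightharpoonup> real) \<Rightarrow> ('a \<rightharpoonup> real)" where
  "relaxation q x = (if \<exists>c. relaxed_bound q x c then Some (Inf {c. relaxed_bound q x c}) else None)"

definition recovery_sequence ::
    "('a::hilbert_space \<rightharpoonup> real) \<Rightarrow> (nat \<Rightarrow> 'a) \<Rightarrow> 'a \<Rightarrow> bool" where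
  "recovery_sequence q u x \<longleftrightarrow> (\<forall>n. u n \<in> dom q) \<and> x \<in> dom (relaxation q) \<and> u \<longlonglongrightarrow> x \<and>
     (\<lambda>n. the (q (u n))) \<longlonglongrightarrow> the (relaxation q x)"

lemma relaxed_boundI:
  assumes "\<And>n. u n \<in> dom q" "u \<longlonglongrightarrow> x"
    and "\<And>e. 0 < e \<Longrightarrow> \<exists>\<^sub>F n in sequentially. the (q (u n)) < c + e"
  shows "relaxed_bound q x c"
  unfolding relaxed_bound_def
proof (intro allI impI)
  fix e :: real assume e: "0 < e"
  have "\<forall>\<^sub>F n in sequentially. norm (u n - x) < e"
    using assms(2) e by (simp add: tendsto_iff dist_norm)
  with assms(3)[OF e] have "\<exists>\<^sub>F n in sequentially. the (q (u n)) < c + e \<and> norm (u n - x) < e"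
    by (rule frequently_eventually_frequently)
  then show "\<exists>v\<in>dom q. norm (v - x) < e \<and> the (q v) < c + e"
    using assms(1) frequently_ex by blast
qed

lemma relaxed_bound_limit:
  assumes "\<And>n. u n \<in> dom q" "u \<longlonglongrightarrow> x" "(\<lambda>n. the (q (u n))) \<longlonglongrightarrow> c"
  shows "relaxed_bound q x c"
proof (rule relaxed_boundI[OF assms(1,2)])
  fix e :: real assume "0 < e"
  then have "\<forall>\<^sub>F n in sequentially. the (q (u n)) < c + e"
    using assms(3) by (intro order_tendstoD(2)) auto
  then show "\<exists>\<^sub>F n in sequentially. the (q (u n)) < c + e"
    by (simp add: eventually_frequently)
qed

context
  fixes q :: "'a::hilbert_space \<rightharpoonup> real"
  assumes pos: "positive_form q"
begin

lemma relaxed_bound_nonneg: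
  assumes "relaxed_bound q x c"
  shows "0 \<le> c"
proof (rule field_le_epsilon)
  fix e :: real assume "0 < e"
  then obtain v where "v \<in> dom q" "the (q v) < c + e"
    using assms unfolding relaxed_bound_def by blast
  then show "0 \<le> c + e" using form_nonneg[OF pos, of v] by simp
qed

lemma relaxed_bounds_bdd: "bdd_below {c. relaxed_bound q x c}"
  using relaxed_bound_nonneg by (intro bdd_belowI[of _ 0]) simp

lemma relaxation_le:
  assumes "relaxed_bound q x c"
  shows "x \<in> dom (relaxation q)" "the (relaxation q x) \<le> c"
  using assms cInf_lower[OF _ relaxed_bounds_bdd, of c x] unfolding relaxation_def dom_def by auto

lemma relaxed_bound_relaxation:
  assumes "x \<in> dom (relaxation q)"
  shows "relaxed_bound q x (the (relaxation q x))"
  unfolding relaxed_bound_def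
proof (intro allI impI)
  fix e :: real assume e: "0 < e"
  have ne: "{c. relaxed_bound q x c} \<noteq> {}"
    and val: "the (relaxation q x) = Inf {c. relaxed_bound q x c}"
    using assms unfolding relaxation_def dom_def by (auto split: if_splits)
  have "Inf {c. relaxed_bound q x c} < the (relaxation q x) + e / 2"
    using val e by simp
  then obtain c where c: "relaxed_bound q x c" "c < the (relaxation q x) + e / 2"
    unfolding cInf_less_iff[OF ne relaxed_bounds_bdd] by auto
  then obtain v where "v \<in> dom q" "norm (v - x) < e / 2" "the (q v) < c + e / 2"
    using e unfolding relaxed_bound_def by (meson half_gt_zero)
  then show "\<exists>v\<in>dom q. norm (v - x) < e \<and> the (q v) < the (relaxation q x) + e"
    using c(2) e by (intro bexI[of _ v]) auto
qed

lemma relaxation_nonneg: "x \<in> dom (relaxation q) \<Longrightarrow> 0 \<le> the (relaxation q x)"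
  using relaxed_bound_nonneg relaxed_bound_relaxation by blast

lemma relaxation_near:
  assumes "x \<in> dom (relaxation q)" "0 < e"
  shows "\<exists>d>0. \<forall>v\<in>dom q. norm (v - x) < d \<longrightarrow> the (relaxation q x) - e < the (q v)"
proof -
  have "\<not> relaxed_bound q x (the (relaxation q x) - e)"
    using relaxation_le(2)[of x "the (relaxation q x) - e"] assms(2) by auto
  then obtain d where d: "0 < d"
    "\<And>v. v \<in> dom q \<Longrightarrow> norm (v - x) < d \<Longrightarrow> the (relaxation q x) - e + d \<le> the (q v)"
    unfolding relaxed_bound_def by (meson not_less)
  then show ?thesis by (intro exI[of _ d]) fastforce
qed

lemma relaxation_eventually_less:
  assumes "x \<in> dom (relaxation q)" "0 < e" "\<And>n. u n \<in> dom q" "u \<longlonglongrightarrow> x"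
  shows "\<forall>\<^sub>F n in sequentially. the (relaxation q x) - e < the (q (u n))"
proof -
  obtain d where d: "0 < d"
    "\<forall>v\<in>dom q. norm (v - x) < d \<longrightarrow> the (relaxation q x) - e < the (q v)"
    using relaxation_near[OF assms(1,2)] by blast
  have "\<forall>\<^sub>F n in sequentially. norm (u n - x) < d"
    using assms(4) d(1) by (simp add: tendsto_iff dist_norm)
  then show ?thesis by eventually_elim (use d(2) assms(3) in blast)
qed

lemma recovery_sequence_exists:
  assumes x: "x \<in> dom (relaxation q)"
  obtains u where "recovery_sequence q u x"
proof -
  let ?T = "the (relaxation q x)"
  have "\<exists>v\<in>dom q. norm (v - x) < 1 / real (Suc n) \<and> the (q v) < ?T + 1 / real (Suc n)" for n
    using relaxed_bound_relaxation[OF x] unfolding relaxed_bound_def by simp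
  then obtain u where u: "\<And>n. u n \<in> dom q" "\<And>n. norm (u n - x) < 1 / real (Suc n)"
      "\<And>n. the (q (u n)) < ?T + 1 / real (Suc n)"
    by metis
  have z: "(\<lambda>n. 1 / real (Suc n)) \<longlonglongrightarrow> 0" by (rule LIMSEQ_Suc[OF lim_1_over_n])
  have "(\<lambda>n. u n - x) \<longlonglongrightarrow> 0"
    by (rule Lim_null_comparison[OF _ z]) (use u(2) less_imp_le in \<open>intro always_eventually allI, blast\<close>)
  then have ux: "u \<longlonglongrightarrow> x" by (rule LIM_zero_cancel)
  have "(\<lambda>n. the (q (u n))) \<longlonglongrightarrow> ?T"
  proof (rule order_tendstoI)
    fix a assume "a < ?T"
    then show "\<forall>\<^sub>F n in sequentially. a < the (q (u n))"
      using relaxation_eventually_less[OF x, of "?T - a" u, OF _ u(1) ux] by simp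
  next
    fix a assume a: "?T < a"
    have "\<forall>\<^sub>F n in sequentially. 1 / real (Suc n) < a - ?T"
      using z a by (intro order_tendstoD(2)) auto
    then show "\<forall>\<^sub>F n in sequentially. the (q (u n)) < a"
    proof eventually_elim
      case (elim n)
      then show ?case using u(3)[of n] by linarith
    qed
  qed
  then show ?thesis using that[of u] u(1) ux x unfolding recovery_sequence_def by blast
qed

text \<open>Midpoints of a recovery sequence still converge to \<open>x\<close>, so their energies cannot drop below
  the relaxed value; by the parallelogram law the differences must lose their energy.\<close>

lemma recovery_sequence_Cauchy:
  assumes rec: "recovery_sequence q u x"
  shows "form_Cauchy q u"
  unfolding form_Cauchy_def
proof (intro conjI allI impI)
  have u: "\<And>n. u n \<in> dom q" and x: "x \<in> dom (relaxation q)" and ux: "u \<longlonglongrightarrow> x"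
    and lim: "(\<lambda>n. the (q (u n))) \<longlonglongrightarrow> the (relaxation q x)"
    using rec unfolding recovery_sequence_def by auto
  show "u n \<in> dom q" for n by (rule u)
  fix e :: real assume e: "0 < e"
  obtain d where d: "0 < d"
    "\<And>v. v \<in> dom q \<Longrightarrow> norm (v - x) < d \<Longrightarrow> the (relaxation q x) - e / 8 < the (q v)"
    using relaxation_near[OF x, of "e / 8"] e by auto
  have "\<forall>\<^sub>F n in sequentially. norm (u n - x) < d"
    using ux d(1) by (simp add: tendsto_iff dist_norm)
  moreover have "\<forall>\<^sub>F n in sequentially. the (q (u n)) < the (relaxation q x) + e / 8"
    using lim e by (intro order_tendstoD(2)) auto
  ultimately have "\<forall>\<^sub>F n in sequentially. norm (u n - x) < d \<and> the (q (u n)) < the (relaxation q x) + e / 8"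
    by eventually_elim blast
  then obtain N where N: "\<And>n. n \<ge> N \<Longrightarrow> norm (u n - x) < d"
      "\<And>n. n \<ge> N \<Longrightarrow> the (q (u n)) < the (relaxation q x) + e / 8"
    unfolding eventually_sequentially by blast
  have "the (q (u m - u n)) < e" if "m \<ge> N" "n \<ge> N" for m n
  proof -
    let ?w = "(1/2) *\<^sub>R (u m + u n)"
    have "?w - x = (1/2) *\<^sub>R ((u m - x) + (u n - x))"
      by (simp add: algebra_simps flip: scaleR_add_left)
    then have "norm (?w - x) = norm ((u m - x) + (u n - x)) / 2" by simp
    then have "norm (?w - x) < d"
      using norm_triangle_ineq[of "u m - x" "u n - x"] N(1)[OF that(1)] N(1)[OF that(2)] by linarith
    then have "the (relaxation q x) - e / 8 < the (q ?w)"
      by (intro d(2)) (intro dom_form_closed[OF pos] u)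
    then show ?thesis
      using form_diff_midpoint[OF pos u u, of m n] N(2)[OF that(1)] N(2)[OF that(2)] by linarith
  qed
  then show "\<exists>N. \<forall>m\<ge>N. \<forall>n\<ge>N. the (q (u m - u n)) < e" by blast
qed

lemma recovery_sequence_scaleK:
  assumes rec: "recovery_sequence q u x" and c: "c \<in> scalars TYPE('a)"
  shows "recovery_sequence q (\<lambda>n. scaleK c (u n)) (scaleK c x)"
    "the (relaxation q (scaleK c x)) = (cmod c)\<^sup>2 * the (relaxation q x)"
proof -
  have le: "scaleK c x \<in> dom (relaxation q) \<and> (\<forall>n. scaleK c (u n) \<in> dom q) \<and>
      (\<lambda>n. scaleK c (u n)) \<longlonglongrightarrow> scaleK c x \<and>
      (\<lambda>n. the (q (scaleK c (u n)))) \<longlonglongrightarrow> (cmod c)\<^sup>2 * the (relaxation q x) \<and>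
      the (relaxation q (scaleK c x)) \<le> (cmod c)\<^sup>2 * the (relaxation q x)"
    if rec: "recovery_sequence q u x" and c: "c \<in> scalars TYPE('a)" for c u x
  proof -
    have u: "\<And>n. u n \<in> dom q" and ux: "u \<longlonglongrightarrow> x"
      and lim: "(\<lambda>n. the (q (u n))) \<longlonglongrightarrow> the (relaxation q x)"
      using rec unfolding recovery_sequence_def by auto
    have 1: "\<And>n. scaleK c (u n) \<in> dom q" by (rule dom_form_closed(5)[OF pos c u])
    have 2: "(\<lambda>n. scaleK c (u n)) \<longlonglongrightarrow> scaleK c x" by (rule tendsto_scaleK[OF c ux])
    have "(\<lambda>n. (cmod c)\<^sup>2 * the (q (u n))) \<longlonglongrightarrow> (cmod c)\<^sup>2 * the (relaxation q x)"
      by (intro tendsto_intros lim)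
    then have 3: "(\<lambda>n. the (q (scaleK c (u n)))) \<longlonglongrightarrow> (cmod c)\<^sup>2 * the (relaxation q x)"
      by (simp add: form_scaleK[OF pos c u])
    show ?thesis
      using 1 2 3 relaxation_le[OF relaxed_bound_limit[OF 1 2 3]] by blast
  qed
  show val: "the (relaxation q (scaleK c x)) = (cmod c)\<^sup>2 * the (relaxation q x)"
  proof (cases "c = 0")
    case True
    then show ?thesis
      using le[OF rec c] relaxation_nonneg[of "scaleK c x"] by simp
  next
    case False
    obtain v where v: "recovery_sequence q v (scaleK c x)"
      using recovery_sequence_exists le[OF rec c] by blast
    have "the (relaxation q x) \<le> (cmod (inverse c))\<^sup>2 * the (relaxation q (scaleK c x))"
      using le[OF v scalars_inverse[OF c]] by (simp add: scaleK_inverse[OF c False])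
    then have "(cmod c)\<^sup>2 * the (relaxation q x)
        \<le> (cmod c)\<^sup>2 * ((cmod (inverse c))\<^sup>2 * the (relaxation q (scaleK c x)))"
      by (intro mult_left_mono) simp_all
    also have "\<dots> = (cmod (c * inverse c))\<^sup>2 * the (relaxation q (scaleK c x))"
      by (simp only: norm_mult power_mult_distrib mult.assoc)
    also have "\<dots> = the (relaxation q (scaleK c x))" using False by simp
    finally have "(cmod c)\<^sup>2 * the (relaxation q x) \<le> the (relaxation q (scaleK c x))" .
    then show ?thesis using le[OF rec c] by simp
  qed
  show "recovery_sequence q (\<lambda>n. scaleK c (u n)) (scaleK c x)"
    unfolding recovery_sequence_def val using le[OF rec c] by blast
qed

text \<open>The parallelogram law survives relaxation: lower semicontinuity gives one inequality, and the
  other is the same inequality for \<open>x + y\<close> and \<open>x - y\<close>. Since both limits are bounded below by their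
  relaxed values and the sum of the limits has no room left, sums of recovery sequences are again
  recovery sequences.\<close>

lemma recovery_sequence_add_diff:
  assumes "recovery_sequence q u x" "recovery_sequence q v y"
  shows "recovery_sequence q (\<lambda>n. u n + v n) (x + y)"
    and "recovery_sequence q (\<lambda>n. u n - v n) (x - y)"
proof -
  let ?T = "\<lambda>x. the (relaxation q x)"
  have half: "x + y \<in> dom (relaxation q) \<and> x - y \<in> dom (relaxation q) \<and>
      (\<lambda>n. the (q (u n + v n)) + the (q (u n - v n))) \<longlonglongrightarrow> 2 * ?T x + 2 * ?T y \<and>
      ?T (x + y) + ?T (x - y) \<le> 2 * ?T x + 2 * ?T y"
    if "recovery_sequence q u x" "recovery_sequence q v y" for u v x y
  proof -
    have u: "\<And>n. u n \<in> dom q" and ux: "u \<longlonglongrightarrow> x" and limu: "(\<lambda>n. the (q (u n))) \<longlonglongrightarrow> ?T x"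
      and v: "\<And>n. v n \<in> dom q" and vy: "v \<longlonglongrightarrow> y" and limv: "(\<lambda>n. the (q (v n))) \<longlonglongrightarrow> ?T y"
      using that unfolding recovery_sequence_def by auto
    have a: "\<And>n. u n + v n \<in> dom q" and b: "\<And>n. u n - v n \<in> dom q"
      using dom_form_closed[OF pos] u v by blast+
    have "(\<lambda>n. 2 * the (q (u n)) + 2 * the (q (v n))) \<longlonglongrightarrow> 2 * ?T x + 2 * ?T y"
      by (intro tendsto_intros limu limv)
    then have S: "(\<lambda>n. the (q (u n + v n)) + the (q (u n - v n))) \<longlonglongrightarrow> 2 * ?T x + 2 * ?T y"
      by (simp add: parallelogram[OF pos u v])
    have bd: "\<exists>\<^sub>F n in sequentially. the (q (u n + v n)) < 2 * ?T x + 2 * ?T y + e \<and>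
        the (q (u n - v n)) < 2 * ?T x + 2 * ?T y + e" if "0 < e" for e
    proof -
      have "\<forall>\<^sub>F n in sequentially. the (q (u n + v n)) + the (q (u n - v n)) < 2 * ?T x + 2 * ?T y + e"
        using S that by (intro order_tendstoD(2)) auto
      then have "\<forall>\<^sub>F n in sequentially. the (q (u n + v n)) < 2 * ?T x + 2 * ?T y + e \<and>
        the (q (u n - v n)) < 2 * ?T x + 2 * ?T y + e"
      proof eventually_elim
        case (elim n)
        then show ?case using form_nonneg[OF pos a[of n]] form_nonneg[OF pos b[of n]] by linarith
      qed
      then show ?thesis by (simp add: eventually_frequently)
    qed
    have la: "(\<lambda>n. u n + v n) \<longlonglongrightarrow> x + y" and lb: "(\<lambda>n. u n - v n) \<longlonglongrightarrow> x - y"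
      by (intro tendsto_intros ux vy)+
    have "relaxed_bound q (x + y) (2 * ?T x + 2 * ?T y)" "relaxed_bound q (x - y) (2 * ?T x + 2 * ?T y)"
      by (rule relaxed_boundI[OF a la] relaxed_boundI[OF b lb]; drule bd; erule frequently_elim1; simp)+
    then have da: "x + y \<in> dom (relaxation q)" and db: "x - y \<in> dom (relaxation q)"
      using relaxation_le(1) by blast+
    have "?T (x + y) + ?T (x - y) \<le> 2 * ?T x + 2 * ?T y"
    proof (rule field_le_epsilon)
      fix e :: real assume e: "0 < e"
      then have "0 < e / 3" by simp
      have "\<forall>\<^sub>F n in sequentially. ?T (x + y) - e / 3 < the (q (u n + v n))"
        by (rule relaxation_eventually_less[OF da \<open>0 < e / 3\<close> a la])
      moreover have "\<forall>\<^sub>F n in sequentially. ?T (x - y) - e / 3 < the (q (u n - v n))"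
        by (rule relaxation_eventually_less[OF db \<open>0 < e / 3\<close> b lb])
      moreover have "\<forall>\<^sub>F n in sequentially.
          the (q (u n + v n)) + the (q (u n - v n)) < 2 * ?T x + 2 * ?T y + e / 3"
        using S \<open>0 < e / 3\<close> by (intro order_tendstoD(2)) auto
      ultimately have "\<forall>\<^sub>F n in sequentially. ?T (x + y) + ?T (x - y) \<le> 2 * ?T x + 2 * ?T y + e"
        by eventually_elim linarith
      then show "?T (x + y) + ?T (x - y) \<le> 2 * ?T x + 2 * ?T y + e" by simp
    qed
    then show ?thesis using da db S by blast
  qed
  note h = half[OF assms]
  obtain w z where w: "recovery_sequence q w (x + y)" and z: "recovery_sequence q z (x - y)"
    using h recovery_sequence_exists by metis
  have double: "?T (2 *\<^sub>R x') = 4 * ?T x'" if "recovery_sequence q u' x'" for u' x'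
    using recovery_sequence_scaleK(2)[OF that, of "of_real 2"] of_real_in_scalars[of 2]
    by (simp only: scaleK_of_real norm_of_real) simp
  have "x + y + (x - y) = 2 *\<^sub>R x" "x + y - (x - y) = 2 *\<^sub>R y" by (simp_all add: scaleR_2)
  then have ge: "2 * ?T x + 2 * ?T y \<le> ?T (x + y) + ?T (x - y)"
    using half[OF w z] double[OF assms(1)] double[OF assms(2)] by simp
  have u: "\<And>n. u n \<in> dom q" and ux: "u \<longlonglongrightarrow> x" and v: "\<And>n. v n \<in> dom q" and vy: "v \<longlonglongrightarrow> y"
    using assms unfolding recovery_sequence_def by auto
  have a: "\<And>n. u n + v n \<in> dom q" and b: "\<And>n. u n - v n \<in> dom q"
    using dom_form_closed[OF pos] u v by blast+
  have la: "(\<lambda>n. u n + v n) \<longlonglongrightarrow> x + y" and lb: "(\<lambda>n. u n - v n) \<longlonglongrightarrow> x - y"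
    by (intro tendsto_intros ux vy)+
  have S: "\<forall>\<^sub>F n in sequentially. the (q (u n + v n)) + the (q (u n - v n)) < ?T (x + y) + ?T (x - y) + e"
    if "0 < e" for e
    by (rule order_tendstoD(2)[of _ "2 * ?T x + 2 * ?T y"]) (use h ge that in auto)
  have A: "\<forall>\<^sub>F n in sequentially. ?T (x + y) - e < the (q (u n + v n))" if "0 < e" for e
    by (rule relaxation_eventually_less[OF _ that a la]) (use h in blast)
  have B: "\<forall>\<^sub>F n in sequentially. ?T (x - y) - e < the (q (u n - v n))" if "0 < e" for e
    by (rule relaxation_eventually_less[OF _ that b lb]) (use h in blast)
  have "(\<lambda>n. the (q (u n + v n))) \<longlonglongrightarrow> ?T (x + y)"
  proof (rule order_tendstoI)
    fix r assume "r < ?T (x + y)"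
    then show "\<forall>\<^sub>F n in sequentially. r < the (q (u n + v n))"
      using A[of "?T (x + y) - r"] by simp
  next
    fix r assume "?T (x + y) < r"
    then have e: "0 < (r - ?T (x + y)) / 2" by simp
    show "\<forall>\<^sub>F n in sequentially. the (q (u n + v n)) < r"
      using S[OF e] B[OF e] by eventually_elim (simp add: field_simps)
  qed
  then show "recovery_sequence q (\<lambda>n. u n + v n) (x + y)"
    unfolding recovery_sequence_def using a la h by blast
  have "(\<lambda>n. the (q (u n - v n))) \<longlonglongrightarrow> ?T (x - y)"
  proof (rule order_tendstoI)
    fix r assume "r < ?T (x - y)"
    then show "\<forall>\<^sub>F n in sequentially. r < the (q (u n - v n))"
      using B[of "?T (x - y) - r"] by simp
  next
    fix r assume "?T (x - y) < r"
    then have e: "0 < (r - ?T (x - y)) / 2" by simp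
    show "\<forall>\<^sub>F n in sequentially. the (q (u n - v n)) < r"
      using S[OF e] A[OF e] by eventually_elim (simp add: field_simps)
  qed
  then show "recovery_sequence q (\<lambda>n. u n - v n) (x - y)"
    unfolding recovery_sequence_def using b lb h by blast
qed

text \<open>Polarization involves only values at sums of recovery sequences, so the sesquilinear forms
  converge too. This is how the relaxation obtains its sesquilinear form.\<close>

lemma recovery_sequence_polar:
  assumes u: "recovery_sequence q u x" and v: "recovery_sequence q v y"
  shows "(\<lambda>n. polar q (u n) (v n)) \<longlonglongrightarrow> polar (relaxation q) x y"
proof -
  have lim: "(\<lambda>n. the (q (w n))) \<longlonglongrightarrow> the (relaxation q z)" if "recovery_sequence q w z" for w z
    using that unfolding recovery_sequence_def by blast
  have real: "(\<lambda>n. of_real ((the (q (w n + z n)) - the (q (w n - z n))) / 4) :: complex)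
      \<longlonglongrightarrow> of_real ((the (relaxation q (a + b)) - the (relaxation q (a - b))) / 4)"
    if "recovery_sequence q w a" "recovery_sequence q z b" for w z a b
    by (intro tendsto_intros lim recovery_sequence_add_diff that) simp
  show ?thesis
  proof (cases "scalars TYPE('a) = UNIV")
    case True
    then have "recovery_sequence q (\<lambda>n. scaleK \<i> (v n)) (scaleK \<i> y)"
      by (intro recovery_sequence_scaleK(1)[OF v]) simp
    then show ?thesis unfolding polar_def if_P[OF True]
      by (intro tendsto_add tendsto_mult_left real u v)
  next
    case False
    show ?thesis unfolding polar_def if_not_P[OF False] add_0_right by (rule real[OF u v])
  qed
qed

lemma relaxation_positive: "positive_form (relaxation q)"
  unfolding positive_form_def
proof (intro conjI exI[of _ "polar (relaxation q)"] ballI)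
  note ex = recovery_sequence_exists
  have rd: "u n \<in> dom q" if "recovery_sequence q u x" for u x n
    using that unfolding recovery_sequence_def by blast
  have rT: "x \<in> dom (relaxation q)" if "recovery_sequence q u x" for u x
    using that unfolding recovery_sequence_def by blast
  show "subspaceK (dom (relaxation q))"
    unfolding subspaceK_def
  proof (intro conjI ballI)
    have "relaxed_bound q 0 0"
      by (rule relaxed_bound_limit[of "\<lambda>_. 0"]) (simp_all add: form_zero[OF pos] dom_form_closed[OF pos])
    then show "0 \<in> dom (relaxation q)" by (rule relaxation_le)
    show "x + y \<in> dom (relaxation q)" if xy: "x \<in> dom (relaxation q)" "y \<in> dom (relaxation q)" for x y
    proof -
      obtain u v where "recovery_sequence q u x" "recovery_sequence q v y" using ex xy by metis
      then show ?thesis using rT recovery_sequence_add_diff(1) by blast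
    qed
    show "scaleK c x \<in> dom (relaxation q)" if c: "c \<in> scalars TYPE('a)" and x: "x \<in> dom (relaxation q)" for c x
    proof -
      obtain u where "recovery_sequence q u x" using ex x by metis
      then show ?thesis using rT recovery_sequence_scaleK(1) c by blast
    qed
  qed
  show "symmetric_sesquilinear_on (dom (relaxation q)) (polar (relaxation q))"
    unfolding symmetric_sesquilinear_on_def
  proof (intro conjI ballI)
    fix x y z c assume d: "x \<in> dom (relaxation q)" "y \<in> dom (relaxation q)"
    obtain u v where u: "recovery_sequence q u x" and v: "recovery_sequence q v y" using ex d by metis
    show "polar (relaxation q) x y \<in> scalars TYPE('a)" by (rule polar_in_scalars)
    have "(\<lambda>n. cnj (polar q (u n) (v n))) \<longlonglongrightarrow> cnj (polar (relaxation q) x y)"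
      by (intro tendsto_intros recovery_sequence_polar u v)
    then show "polar (relaxation q) y x = cnj (polar (relaxation q) x y)"
      using recovery_sequence_polar[OF v u]
      by (simp add: LIMSEQ_unique polar_commute[OF pos rd[OF u] rd[OF v]])
    show "polar (relaxation q) (x + y) z = polar (relaxation q) x z + polar (relaxation q) y z"
      if "z \<in> dom (relaxation q)"
    proof -
      obtain w where w: "recovery_sequence q w z" using ex \<open>z \<in> _\<close> by metis
      have "(\<lambda>n. polar q (u n) (w n) + polar q (v n) (w n))
          \<longlonglongrightarrow> polar (relaxation q) x z + polar (relaxation q) y z"
        by (intro tendsto_intros recovery_sequence_polar u v w)
      then show ?thesis
        using recovery_sequence_polar[OF recovery_sequence_add_diff(1)[OF u v] w]
        by (simp add: LIMSEQ_unique polar_add[OF pos rd[OF u] rd[OF v] rd[OF w]])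
    qed
    show "polar (relaxation q) (scaleK c x) y = c * polar (relaxation q) x y"
      if c: "c \<in> scalars TYPE('a)"
    proof -
      have "(\<lambda>n. c * polar q (u n) (v n)) \<longlonglongrightarrow> c * polar (relaxation q) x y"
        by (intro tendsto_intros recovery_sequence_polar u v)
      then show ?thesis
        using recovery_sequence_polar[OF recovery_sequence_scaleK(1)[OF u c] v]
        by (simp add: LIMSEQ_unique polar_scaleK[OF pos c rd[OF u] rd[OF v]])
    qed
  qed
  fix x assume x: "x \<in> dom (relaxation q)"
  then obtain u where u: "recovery_sequence q u x" using ex by metis
  have "(\<lambda>n. complex_of_real (the (q (u n)))) \<longlonglongrightarrow> of_real (the (relaxation q x))"
    using u unfolding recovery_sequence_def by (intro tendsto_intros) blast
  then show "polar (relaxation q) x x = of_real (the (relaxation q x))"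
    using recovery_sequence_polar[OF u u] by (simp add: LIMSEQ_unique polar_self[OF pos rd[OF u]])
  show "0 \<le> the (relaxation q x)" by (rule relaxation_nonneg[OF x])
qed

lemma relaxation_below:
  assumes "x \<in> dom q"
  shows "x \<in> dom (relaxation q)" "the (relaxation q x) \<le> the (q x)"
  using relaxation_le[OF relaxed_bound_limit[of "\<lambda>_. x"]] assms by auto

text \<open>The relaxation is lower semicontinuous on the whole space: relaxing it once more gives nothing
  new, since almost optimal vectors for the second step can be approximated in the first.\<close>

lemma relaxed_bound_idem:
  assumes "relaxed_bound (relaxation q) x c"
  shows "relaxed_bound q x c"
  unfolding relaxed_bound_def
proof (intro allI impI)
  fix e :: real assume "0 < e"
  then have e: "0 < e / 2" by simp
  obtain v where v: "v \<in> dom (relaxation q)" "norm (v - x) < e / 2" "the (relaxation q v) < c + e / 2"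
    using assms e unfolding relaxed_bound_def by blast
  obtain w where w: "w \<in> dom q" "norm (w - v) < e / 2" "the (q w) < the (relaxation q v) + e / 2"
    using relaxed_bound_relaxation[OF v(1)] e unfolding relaxed_bound_def by blast
  have "norm (w - x) < e"
    using norm_triangle_ineq[of "w - v" "v - x"] v w by simp
  then show "\<exists>v\<in>dom q. norm (v - x) < e \<and> the (q v) < c + e"
    using v w by (intro bexI[of _ w]) auto
qed

text \<open>For a Cauchy sequence the energy of \<open>u n - x\<close> is at most that of \<open>u n - u m\<close> for large \<open>m\<close>, by
  lower semicontinuity; hence the relaxation is closed.\<close>

lemma relaxation_Cauchy_tendsto:
  assumes C: "form_Cauchy (relaxation q) u" and ux: "u \<longlonglongrightarrow> x"
  shows "form_tendsto (relaxation q) u x"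
proof -
  note cl = dom_form_closed[OF relaxation_positive]
  have u: "\<And>n. u n \<in> dom (relaxation q)" using C unfolding form_Cauchy_def by blast
  have key: "\<exists>N. \<forall>n\<ge>N. u n - x \<in> dom (relaxation q) \<and> the (relaxation q (u n - x)) \<le> e" if e: "0 < e" for e
  proof -
    obtain N where N: "\<And>m n. m \<ge> N \<Longrightarrow> n \<ge> N \<Longrightarrow> the (relaxation q (u m - u n)) < e"
      using C e unfolding form_Cauchy_def by meson
    have "relaxed_bound (relaxation q) (u n - x) e" if n: "n \<ge> N" for n
    proof (rule relaxed_boundI)
      show "u n - u m \<in> dom (relaxation q)" for m by (intro cl u)
      show "(\<lambda>m. u n - u m) \<longlonglongrightarrow> u n - x" by (intro tendsto_intros ux)
      fix d :: real assume "0 < d"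
      then have "\<forall>\<^sub>F m in sequentially. the (relaxation q (u n - u m)) < e + d"
        using N[OF n] unfolding eventually_sequentially by (meson add_less_cancel_left less_add_same_cancel1 less_trans)
      then show "\<exists>\<^sub>F m in sequentially. the (relaxation q (u n - u m)) < e + d"
        by (simp add: eventually_frequently)
    qed
    then show ?thesis using relaxation_le[OF relaxed_bound_idem] by blast
  qed
  obtain n where n: "u n - x \<in> dom (relaxation q)" using key[of 1] by (meson order_refl zero_less_one)
  have "u n - (u n - x) \<in> dom (relaxation q)" by (rule cl(3)[OF u n])
  then have x: "x \<in> dom (relaxation q)" by simp
  have "(\<lambda>n. the (relaxation q (u n - x))) \<longlonglongrightarrow> 0"
  proof (rule LIMSEQ_I)
    fix e :: real assume e: "0 < e"
    then obtain N where N: "\<And>n. n \<ge> N \<Longrightarrow> the (relaxation q (u n - x)) \<le> e / 2"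
      using key[of "e / 2"] by auto
    have "norm (the (relaxation q (u n - x)) - 0) < e" if "n \<ge> N" for n
      using N[OF that] relaxation_nonneg[OF cl(3)[OF u x], of n] e by simp
    then show "\<exists>N. \<forall>n\<ge>N. norm (the (relaxation q (u n - x)) - 0) < e" by blast
  qed
  then show ?thesis unfolding form_tendsto_def using u x by blast
qed

lemma relaxation_closed: "closed_form (relaxation q)"
  unfolding closed_form_def
proof (intro conjI allI impI relaxation_positive)
  fix u assume "form_Cauchy (form_plus (relaxation q) 1) u"
  then have C: "form_Cauchy (relaxation q) u" "Cauchy u"
    using form_Cauchy_plus[OF relaxation_positive, of 1] by simp_all
  then obtain x where "u \<longlonglongrightarrow> x" using Cauchy_convergent convergentD by blast
  then show "\<exists>x. form_tendsto (form_plus (relaxation q) 1) u x"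
    using form_tendsto_plus[OF relaxation_positive, of 1] relaxation_Cauchy_tendsto[OF C(1)] by auto
qed

lemma recovery_sequence_tendsto:
  assumes rec: "recovery_sequence q u x"
  shows "form_tendsto (relaxation q) u x"
proof (rule relaxation_Cauchy_tendsto)
  have C: "form_Cauchy q u" by (rule recovery_sequence_Cauchy[OF rec])
  then have d: "u m - u n \<in> dom q" for m n
    unfolding form_Cauchy_def by (simp add: dom_form_closed[OF pos])
  show "form_Cauchy (relaxation q) u"
    unfolding form_Cauchy_def
  proof (intro conjI allI impI)
    show "u n \<in> dom (relaxation q)" for n
      using C relaxation_below(1) unfolding form_Cauchy_def by blast
    fix e :: real assume "0 < e"
    then show "\<exists>N. \<forall>m\<ge>N. \<forall>n\<ge>N. the (relaxation q (u m - u n)) < e"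
      using C relaxation_below(2)[OF d] unfolding form_Cauchy_def by (meson le_less_trans)
  qed
  show "u \<longlonglongrightarrow> x" using rec unfolding recovery_sequence_def by blast
qed

end


lemma dense_dom_relaxation:
  assumes "positive_form q" "closure (dom q) = UNIV"
  shows "closure (dom (relaxation q)) = UNIV"
proof -
  have "dom q \<subseteq> dom (relaxation q)" using relaxation_below(1)[OF assms(1)] by blast
  from closure_mono[OF this] show ?thesis using assms(2) by blast
qed

text \<open>Closed forms are lower semicontinuous: a recovery sequence for a closed form converges in
  the form norm.\<close>

lemma relaxation_of_closed:
  assumes c: "closed_form c"
  shows "relaxation c = c"
proof
  fix x
  note pos = positive_if_closed[OF c]
  have "c x = relaxation c x" if x: "x \<in> dom (relaxation c)"
  proof -
    obtain u where u: "recovery_sequence c u x" using recovery_sequence_exists[OF pos x] by blast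
    have lim: "u \<longlonglongrightarrow> x" "(\<lambda>n. the (c (u n))) \<longlonglongrightarrow> the (relaxation c x)"
      using u unfolding recovery_sequence_def by blast+
    obtain y where y: "form_tendsto c u y" "u \<longlonglongrightarrow> y"
      using closed_form_complete[OF c recovery_sequence_Cauchy[OF pos u] LIMSEQ_imp_Cauchy[OF lim(1)]]
      by blast
    have "y = x" using LIMSEQ_unique lim(1) y(2) by blast
    moreover have "the (c y) = the (relaxation c x)"
      using LIMSEQ_unique form_tendsto_value[OF pos y(1)] lim(2) by blast
    moreover have "y \<in> dom c" using y(1) unfolding form_tendsto_def by blast
    ultimately show ?thesis using x by (auto intro: option.expand)
  qed
  moreover have "c x = relaxation c x" if x: "x \<notin> dom (relaxation c)"
    using relaxation_below(1)[OF pos, of x] x unfolding domIff by metis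
  ultimately show "relaxation c x = c x" by metis
qed

lemma closed_form_closable:
  assumes c: "closed_form c"
  shows "closable_form c"
  unfolding closable_form_def
proof (intro conjI allI impI)
  show pos: "positive_form c" by (rule positive_if_closed[OF c])
  fix u assume u: "form_Cauchy c u \<and> u \<longlonglongrightarrow> 0"
  then obtain y where y: "form_tendsto c u y" "u \<longlonglongrightarrow> y"
    using closed_form_complete[OF c] LIMSEQ_imp_Cauchy by metis
  have "y = 0" using LIMSEQ_unique u y(2) by blast
  then show "(\<lambda>n. the (c (u n))) \<longlonglongrightarrow> 0"
    using form_tendsto_value[OF pos y(1)] form_zero[OF pos] by simp
qed

text \<open>A closable form converges along a recovery sequence of any form that dominates it, because
  that sequence is Cauchy for both.\<close>

lemma closable_minorant_le_relaxation:
  assumes q: "positive_form q" and r: "closable_form r" and dom_eq: "dom r = dom q"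
    and le: "\<And>u. u \<in> dom q \<Longrightarrow> the (r u) \<le> the (q u)" and x: "x \<in> dom q"
  shows "the (r x) \<le> the (relaxation q x)"
proof -
  have r_pos: "positive_form r" and closable:
    "\<And>u. form_Cauchy r u \<Longrightarrow> u \<longlonglongrightarrow> 0 \<Longrightarrow> (\<lambda>n. the (r (u n))) \<longlonglongrightarrow> 0"
    using r unfolding closable_form_def by blast+
  note cl = dom_form_closed[OF q]
  obtain u where rec: "recovery_sequence q u x"
    using recovery_sequence_exists[OF q relaxation_below(1)[OF q x]] by blast
  then have u: "\<And>n. u n \<in> dom q" and ux: "u \<longlonglongrightarrow> x"
    and lim: "(\<lambda>n. the (q (u n))) \<longlonglongrightarrow> the (relaxation q x)"
    unfolding recovery_sequence_def by blast+
  have "form_Cauchy r (\<lambda>n. u n - x)"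
    unfolding form_Cauchy_def
  proof (intro conjI allI impI)
    show "u n - x \<in> dom r" for n using cl(3)[OF u x] dom_eq by simp
    fix e :: real assume "0 < e"
    then show "\<exists>N. \<forall>m\<ge>N. \<forall>n\<ge>N. the (r (u m - x - (u n - x))) < e"
      using recovery_sequence_Cauchy[OF q rec] le[OF cl(3)[OF u u]]
      unfolding form_Cauchy_def by simp (meson le_less_trans)
  qed
  moreover have "(\<lambda>n. u n - x) \<longlonglongrightarrow> 0" using ux by (rule LIM_zero)
  ultimately have "(\<lambda>n. the (r (u n - x))) \<longlonglongrightarrow> 0" by (rule closable)
  then have "form_tendsto r u x" unfolding form_tendsto_def using u x dom_eq by simp
  then have "(\<lambda>n. the (r (u n))) \<longlonglongrightarrow> the (r x)" by (rule form_tendsto_value[OF r_pos])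
  then show ?thesis by (rule LIMSEQ_le[OF _ lim]) (use le[OF u] in blast)
qed

text \<open>The restriction is closable because it extends to a closed form, and it dominates every other
  closable minorant by lower semicontinuity along recovery sequences.\<close>

lemma regular_part_eq_relaxation:
  assumes q: "positive_form q" and dense: "closure (dom q) = UNIV"
  shows "regular_part q = relaxation q |` dom q"
proof -
  let ?r = "relaxation q |` dom q"
  have sub: "dom q \<subseteq> dom (relaxation q)" using relaxation_below(1)[OF q] by blast
  then have dom_r: "dom ?r = dom q" by auto
  have the_r: "the (?r u) = the (relaxation q u)" if "u \<in> dom q" for u using that by simp
  have T: "positive_form (relaxation q)" by (rule relaxation_positive[OF q])
  have r_pos: "positive_form ?r"
    unfolding positive_form_def dom_r
  proof (intro conjI exI[of _ "polar (relaxation q)"] ballI dom_subspace[OF q])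
    show "symmetric_sesquilinear_on (dom q) (polar (relaxation q))"
      using polar_sesquilinear[OF T] sub unfolding symmetric_sesquilinear_on_def by (meson subsetD)
  qed (use polar_self[OF T] form_nonneg[OF T] sub in \<open>auto simp: the_r subset_iff\<close>)
  have "closable_form ?r"
    unfolding closable_form_def
  proof (intro conjI allI impI r_pos)
    fix u assume u: "form_Cauchy ?r u \<and> u \<longlonglongrightarrow> 0"
    then have d: "\<And>n. u n \<in> dom q" unfolding form_Cauchy_def dom_r by blast
    then have "form_Cauchy (relaxation q) u"
      using u sub unfolding form_Cauchy_def by (auto simp: the_r dom_form_closed[OF q] subset_iff)
    then have "(\<lambda>n. the (relaxation q (u n))) \<longlonglongrightarrow> 0"
      using closed_form_closable[OF relaxation_closed[OF q]] u unfolding closable_form_def by blast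
    then show "(\<lambda>n. the (?r (u n))) \<longlonglongrightarrow> 0" by (simp only: the_r[OF d])
  qed
  then have r_in: "?r \<in> closable_minorants q"
    unfolding closable_minorants_def using r_pos dense dom_r relaxation_below(2)[OF q]
    by (simp add: the_r)
  have r_max: "the (r' u) \<le> the (?r u)" if "r' \<in> closable_minorants q" "u \<in> dom q" for r' u
    unfolding the_r[OF that(2)] using that unfolding closable_minorants_def
    by (intro closable_minorant_le_relaxation[OF q]) auto
  show ?thesis
    unfolding regular_part_def
  proof (rule the_equality)
    show "?r \<in> closable_minorants q \<and> (\<forall>r'\<in>closable_minorants q. \<forall>u\<in>dom q. the (r' u) \<le> the (?r u))"
      using r_in r_max by blast
    fix r assume r: "r \<in> closable_minorants q \<and>
      (\<forall>r'\<in>closable_minorants q. \<forall>u\<in>dom q. the (r' u) \<le> the (r u))"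
    then have dr: "dom r = dom q" unfolding closable_minorants_def by blast
    have eq: "the (r u) = the (?r u)" if "u \<in> dom q" for u
    proof (rule antisym)
      show "the (r u) \<le> the (?r u)" using r r_max that by blast
      show "the (?r u) \<le> the (r u)" using r r_in that by blast
    qed
    show "r = ?r"
    proof
      fix u
      show "r u = ?r u"
      proof (cases "u \<in> dom q")
        case True
        then have "u \<in> dom r" "u \<in> dom ?r" using dr dom_r by blast+
        then show ?thesis using eq[OF True] by (auto intro: option.expand)
      next
        case False
        then have "u \<notin> dom r" "u \<notin> dom ?r" using dr dom_r by blast+
        then show ?thesis unfolding domIff by simp
      qed
    qed
  qed
qed

text \<open>Recovery sequences lie in \<open>dom q\<close> and converge in the form norm, so \<open>dom q\<close> is a core of the
  relaxation and every closed extension of the regular part contains the relaxation.\<close>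

lemma form_closure_regular_part:
  assumes q: "positive_form q" and dense: "closure (dom q) = UNIV"
  shows "form_closure (regular_part q) = relaxation q"
  unfolding form_closure_def
proof (rule the_equality)
  let ?r = "regular_part q" and ?T = "relaxation q"
  have r_eq: "?r = ?T |` dom q" by (rule regular_part_eq_relaxation[OF assms])
  have T: "positive_form ?T" by (rule relaxation_positive[OF q])
  have ext: "?r \<subseteq>\<^sub>m ?T" unfolding r_eq map_le_def by auto
  have least: "?T \<subseteq>\<^sub>m c" if c: "closed_form c" "?r \<subseteq>\<^sub>m c" for c
    unfolding map_le_def
  proof
    fix x assume x: "x \<in> dom ?T"
    note cp = positive_if_closed[OF c(1)]
    have on_q: "w \<in> dom c \<and> the (c w) = the (?T w)" if w: "w \<in> dom q" for w
    proof -
      have "?r w = ?T w" "w \<in> dom ?r" unfolding r_eq using w relaxation_below(1)[OF q w] by auto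
      then have "c w = ?T w" "w \<in> dom ?T"
        using c(2) relaxation_below(1)[OF q w] unfolding map_le_def by metis+
      then show ?thesis by (simp add: domIff)
    qed
    obtain u where rec: "recovery_sequence q u x" using recovery_sequence_exists[OF q x] by blast
    then have u: "\<And>n. u n \<in> dom q" and ux: "u \<longlonglongrightarrow> x" unfolding recovery_sequence_def by blast+
    have uq: "u m - u n \<in> dom q" for m n by (intro dom_form_closed(3)[OF q] u)
    have "form_Cauchy c u"
      unfolding form_Cauchy_def
    proof (intro conjI allI impI)
      show "u n \<in> dom c" for n using on_q u by blast
      fix e :: real assume "0 < e"
      then show "\<exists>N. \<forall>m\<ge>N. \<forall>n\<ge>N. the (c (u m - u n)) < e"
        using recovery_sequence_Cauchy[OF q rec] relaxation_below(2)[OF q uq] on_q[OF uq]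
        unfolding form_Cauchy_def by (metis le_less_trans)
    qed
    then obtain y where y: "form_tendsto c u y" "u \<longlonglongrightarrow> y"
      using closed_form_complete[OF c(1)] LIMSEQ_imp_Cauchy[OF ux] by metis
    have yx: "y = x" using LIMSEQ_unique ux y(2) by blast
    have "(\<lambda>n. the (c (u n))) \<longlonglongrightarrow> the (?T x)"
      using form_tendsto_value[OF T recovery_sequence_tendsto[OF q rec]] on_q[OF u] by simp
    then have "the (c x) = the (?T x)"
      using form_tendsto_value[OF cp y(1)] yx LIMSEQ_unique by blast
    moreover have "x \<in> dom c" using y(1) yx unfolding form_tendsto_def by blast
    ultimately show "?T x = c x" using x by (auto intro: option.expand)
  qed
  show "closed_form ?T \<and> ?r \<subseteq>\<^sub>m ?T \<and> (\<forall>c'. closed_form c' \<and> ?r \<subseteq>\<^sub>m c' \<longrightarrow> ?T \<subseteq>\<^sub>m c')"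
    using relaxation_closed[OF q] ext least by blast
  fix c assume c: "closed_form c \<and> ?r \<subseteq>\<^sub>m c \<and> (\<forall>c'. closed_form c' \<and> ?r \<subseteq>\<^sub>m c' \<longrightarrow> c \<subseteq>\<^sub>m c')"
  then have "c \<subseteq>\<^sub>m ?T" using relaxation_closed[OF q] ext by blast
  moreover have "?T \<subseteq>\<^sub>m c" using c least by blast
  ultimately show "c = ?T" by (rule map_le_antisym)
qed


section \<open>Operators of closed forms\<close>

text \<open>The solution is \<open>l (H + l)\<^sup>-\<^sup>1 f\<close> for the operator \<open>H\<close> of \<open>c\<close>: it represents the functional
  \<open>v \<mapsto> l \<langle>f, v\<rangle>\<close> in the scalar product of \<open>form_plus c l\<close>.\<close>

lemma closed_form_resolvent:
  fixes c :: "'a::hilbert_space \<rightharpoonup> real"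
  assumes c: "closed_form c" and l: "0 < l"
  obtains u where "u \<in> dom c" "\<And>v. v \<in> dom c \<Longrightarrow> polar c u v = ip (l *\<^sub>R (f - u)) v"
proof -
  note pos = positive_if_closed[OF c]
  let ?p = "form_plus c l"
  have p: "positive_form ?p" using form_plus_positive[OF pos] l by simp
  have "\<exists>u\<in>dom c. \<forall>v\<in>dom c. Re (polar ?p u v) = l * Re (ip f v)"
  proof (rule riesz_representation[OF p dom_subspace[OF pos]])
    fix u assume "form_Cauchy ?p u"
    then have "form_Cauchy c u" "Cauchy u" using form_Cauchy_plus[OF pos l] by blast+
    then obtain x where x: "form_tendsto c u x" "u \<longlonglongrightarrow> x" by (rule closed_form_complete[OF c])
    then show "\<exists>x\<in>dom c. form_tendsto ?p u x"
      using form_tendsto_plus[OF pos l] unfolding form_tendsto_def[of c] by blast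
  next
    fix v assume v: "v \<in> dom c"
    have "\<bar>Re (ip f v)\<bar> \<le> norm f * norm v"
      using Re_ip_le[of f v] Re_ip_le[of f "-1 *\<^sub>R v"] ip_diff_right[of f 0 v] ip_diff_right[of f 0 0]
      by simp
    then have "(Re (ip f v))\<^sup>2 \<le> (norm f * norm v)\<^sup>2"
      by (metis abs_ge_zero power2_abs power_mono)
    then have "(l * Re (ip f v))\<^sup>2 \<le> l\<^sup>2 * ((norm f)\<^sup>2 * (norm v)\<^sup>2)"
      using l by (simp add: power_mult_distrib)
    also have "\<dots> = (l * (norm f)\<^sup>2) * (l * (norm v)\<^sup>2)" by (simp add: power2_eq_square)
    also have "\<dots> \<le> (l * (norm f)\<^sup>2) * the (?p v)"
      using l form_nonneg[OF pos v] by (intro mult_left_mono) (simp_all add: the_form_plus[OF v])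
    finally show "(l * Re (ip f v))\<^sup>2 \<le> (l * (norm f)\<^sup>2) * the (?p v)" .
  next
    show "l * Re (ip f (r *\<^sub>R u)) = r * (l * Re (ip f u))" for r u
      using ip_scaleK_right[OF of_real_in_scalars, of f r u] by (simp add: scaleK_of_real)
  qed (use l in \<open>simp_all add: ip_add_right algebra_simps\<close>)
  then obtain u where u: "u \<in> dom c" and eq: "\<And>v. v \<in> dom c \<Longrightarrow> Re (polar ?p u v) = l * Re (ip f v)"
    by blast
  have "polar c u v - ip (l *\<^sub>R (f - u)) v = 0" if "v \<in> dom c" for v
  proof (rule antilinear_zero_if_Re_zero[OF dom_subspace[OF pos] _ _ _ that])
    show "polar c u v - ip (l *\<^sub>R (f - u)) v \<in> scalars TYPE('a)" for v
      by (intro scalars_diff polar_in_scalars ip_in_scalars)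
    show "polar c u (scaleK k v) - ip (l *\<^sub>R (f - u)) (scaleK k v)
        = cnj k * (polar c u v - ip (l *\<^sub>R (f - u)) v)" if "k \<in> scalars TYPE('a)" "v \<in> dom c" for k v
      using polar_scaleK_right[OF pos that u] ip_scaleK_right[OF that(1)] by (simp add: algebra_simps)
    show "Re (polar c u v - ip (l *\<^sub>R (f - u)) v) = 0" if "v \<in> dom c" for v
      using eq[OF that] polar_form_plus[OF pos _ u that, of l] l
      by (simp add: ip_scaleR ip_diff algebra_simps)
  qed
  then show ?thesis using u that by simp
qed

text \<open>The weak equation for \<open>u\<close> is the Euler equation of the functional \<open>c[v] + \<parallel>v - f\<parallel>\<^sup>2\<close>, and
  the functional exceeds its minimum by the form norm of the deviation.\<close>

lemma resolvent_minimizes: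
  assumes pos: "positive_form c" and u: "u \<in> dom c"
    and eq: "\<And>v. v \<in> dom c \<Longrightarrow> polar c u v = ip (f - u) v" and v: "v \<in> dom c"
  shows "the (c v) + (norm (v - f))\<^sup>2
    = the (c u) + (norm (u - f))\<^sup>2 + the (c (v - u)) + (norm (v - u))\<^sup>2"
proof -
  have w: "v - u \<in> dom c" by (rule dom_form_closed(3)[OF pos v u])
  have "Re (ip (u - f) (v - u)) = - Re (polar c u (v - u))"
    unfolding eq[OF w] ip_diff[of u f] ip_diff[of f u] by simp
  then show ?thesis
    using form_add[OF pos u w] norm_add_square[of "u - f" "v - u"] by (simp add: algebra_simps)
qed

context
  fixes c :: "'a::hilbert_space \<rightharpoonup> real"
  assumes closed: "closed_form c" and dense: "closure (dom c) = UNIV"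
begin

private lemma pos: "positive_form c"
  by (rule positive_if_closed[OF closed])

lemma form_operator_eq_Some:
  "form_operator c u = Some w \<longleftrightarrow> u \<in> dom c \<and> (\<forall>v\<in>dom c. polar c u v = ip w v)"
proof -
  have the_w: "(THE w. \<forall>v\<in>dom c. polar c u v = ip w v) = w"
    if w: "\<forall>v\<in>dom c. polar c u v = ip w v" for w
  proof (rule the_equality[of "\<lambda>w. \<forall>v\<in>dom c. polar c u v = ip w v", OF w])
    fix w' assume "\<forall>v\<in>dom c. polar c u v = ip w' v"
    then show "w' = w" using w by (intro ip_eq_on_dense[OF dense]) simp
  qed
  show ?thesis
  proof (cases "u \<in> dom c \<and> (\<exists>w. \<forall>v\<in>dom c. polar c u v = ip w v)")
    case True
    then obtain w' where w': "\<forall>v\<in>dom c. polar c u v = ip w' v" by blast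
    have Hu: "form_operator c u = Some w'"
      unfolding form_operator_def if_P[OF True] the_w[OF w'] ..
    have "w' = w" if "\<forall>v\<in>dom c. polar c u v = ip w v"
      using the_w[OF w'] the_w[OF that] by (rule trans[OF sym])
    then show ?thesis unfolding Hu using True w' by blast
  next
    case False
    then show ?thesis unfolding form_operator_def by auto
  qed
qed

lemma resolvent_unique:
  assumes u: "u \<in> dom c" "\<And>v. v \<in> dom c \<Longrightarrow> polar c u v = ip (f - u) v"
    and u': "u' \<in> dom c" "\<And>v. v \<in> dom c \<Longrightarrow> polar c u' v = ip (f - u') v"
  shows "u = u'"
proof -
  have "the (c u) + (norm (u - f))\<^sup>2 + the (c (u' - u)) + (norm (u' - u))\<^sup>2 = the (c u') + (norm (u' - f))\<^sup>2"
    "the (c u') + (norm (u' - f))\<^sup>2 + the (c (u - u')) + (norm (u - u'))\<^sup>2 = the (c u) + (norm (u - f))\<^sup>2"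
    using resolvent_minimizes[OF pos u u'(1)] resolvent_minimizes[OF pos u' u(1)] by simp_all
  moreover have "0 \<le> the (c (u' - u))" "0 \<le> the (c (u - u'))"
    using form_nonneg[OF pos] dom_form_closed(3)[OF pos] u u' by blast+
  ultimately have "(norm (u - u'))\<^sup>2 \<le> 0"
    using zero_le_power2[of "norm (u' - u)"] by linarith
  then show ?thesis by simp
qed

lemma inverse_plus_one_form_operator:
  "inverse_plus_one (form_operator c) f = u \<longleftrightarrow>
    u \<in> dom c \<and> (\<forall>v\<in>dom c. polar c u v = ip (f - u) v)" (is "_ \<longleftrightarrow> ?weak u")
proof -
  have iff: "u \<in> dom (form_operator c) \<and> the (form_operator c u) + u = f \<longleftrightarrow> ?weak u" for u
  proof -
    have "u \<in> dom (form_operator c) \<and> the (form_operator c u) + u = f \<longleftrightarrow> form_operator c u = Some (f - u)"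
      by (auto simp: dom_def)
    then show ?thesis by (simp only: form_operator_eq_Some)
  qed
  obtain x where x: "?weak x"
    using closed_form_resolvent[OF closed, of 1 f] by (metis scaleR_one zero_less_one)
  have un: "y = x" if "?weak y" for y using resolvent_unique that x by blast
  have "inverse_plus_one (form_operator c) f = x"
    unfolding inverse_plus_one_def iff by (rule the_equality[of ?weak, OF x un])
  then show ?thesis using x un by blast
qed

text \<open>The vectors \<open>u n = (n + 1) (H + n + 1)\<^sup>-\<^sup>1 x\<close> converge to \<open>x\<close>, without exceeding its energy.\<close>

lemma form_operator_approximation:
  assumes x: "x \<in> dom c"
  obtains u where "\<And>n. u n \<in> dom (form_operator c)" "u \<longlonglongrightarrow> x" "\<And>n. the (c (u n)) \<le> the (c x)"
proof -
  have "\<exists>u\<in>dom (form_operator c). the (c u) \<le> the (c x) \<and>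
      (norm (u - x))\<^sup>2 \<le> the (c x) * (1 / real (Suc n))" for n
  proof -
    obtain u where u: "u \<in> dom c" and eq: "\<And>v. v \<in> dom c \<Longrightarrow> polar c u v = ip (real (Suc n) *\<^sub>R (x - u)) v"
      using closed_form_resolvent[OF closed, of "real (Suc n)" x] by auto
    have w: "x - u \<in> dom c" by (rule dom_form_closed(3)[OF pos x u])
    have "form_operator c u = Some (real (Suc n) *\<^sub>R (x - u))"
      unfolding form_operator_eq_Some using u eq by blast
    then have dom: "u \<in> dom (form_operator c)" by blast
    have "Re (polar c u (x - u)) = real (Suc n) * (norm (x - u))\<^sup>2"
      unfolding eq[OF w] ip_scaleR ip_self by simp
    then have "the (c x) = the (c u) + the (c (x - u)) + 2 * (real (Suc n) * (norm (x - u))\<^sup>2)"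
      using form_add[OF pos u w] by simp
    moreover have "0 \<le> real (Suc n) * (norm (x - u))\<^sup>2" by simp
    ultimately have "the (c u) \<le> the (c x)" "real (Suc n) * (norm (x - u))\<^sup>2 \<le> the (c x)"
      using form_nonneg[OF pos u] form_nonneg[OF pos w] by linarith+
    then show ?thesis using dom
      by (intro bexI[of _ u]) (simp_all add: norm_minus_commute field_simps)
  qed
  then obtain u where u: "\<And>n. u n \<in> dom (form_operator c)" "\<And>n. the (c (u n)) \<le> the (c x)"
      "\<And>n. (norm (u n - x))\<^sup>2 \<le> the (c x) * (1 / real (Suc n))"
    by metis
  have "(\<lambda>n. sqrt (the (c x) * (1 / real (Suc n)))) \<longlonglongrightarrow> sqrt (the (c x) * 0)"
    by (intro tendsto_intros LIMSEQ_Suc[OF lim_1_over_n])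
  then have "(\<lambda>n. sqrt (the (c x) * (1 / real (Suc n)))) \<longlonglongrightarrow> 0" by simp
  then have "(\<lambda>n. u n - x) \<longlonglongrightarrow> 0"
    by (rule Lim_null_comparison[rotated]) (intro always_eventually allI real_le_rsqrt u(3))
  then show ?thesis using that u(1,2) LIM_zero_cancel by blast
qed

lemma dense_dom_form_operator: "closure (dom (form_operator c)) = UNIV"
proof -
  have "dom c \<subseteq> closure (dom (form_operator c))"
  proof
    fix x assume "x \<in> dom c"
    then obtain u where "\<And>n. u n \<in> dom (form_operator c)" "u \<longlonglongrightarrow> x"
      using form_operator_approximation by blast
    then show "x \<in> closure (dom (form_operator c))" unfolding closure_sequential by blast
  qed
  then have "closure (dom c) \<subseteq> closure (dom (form_operator c))" by (rule closure_minimal) simp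
  then show ?thesis using dense by blast
qed

text \<open>A symmetric operator \<open>H\<close> for which \<open>H + 1\<close> is onto is self-adjoint: a vector \<open>v\<close> in the domain of
  the adjoint agrees with the solution of \<open>(H + 1) v' = (H\<^sup>* + 1) v\<close>.\<close>

lemma form_operator_positive_selfadjoint: "positive_selfadjoint (form_operator c)"
  unfolding positive_selfadjoint_def
proof (intro conjI ballI dense_dom_form_operator)
  let ?H = "form_operator c"
  have weak: "u \<in> dom c" "v \<in> dom c \<Longrightarrow> polar c u v = ip (the (?H u)) v" if "u \<in> dom ?H" for u v
    using that form_operator_eq_Some[of u "the (?H u)"] by auto
  show "linear_operator ?H"
  proof -
    have add: "?H (x + y) = Some (the (?H x) + the (?H y))" if "x \<in> dom ?H" "y \<in> dom ?H" for x y
      unfolding form_operator_eq_Some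
      using weak[OF that(1)] weak[OF that(2)] by (simp add: dom_form_closed[OF pos] polar_add[OF pos] ip_add)
    have sc: "?H (scaleK k x) = Some (scaleK k (the (?H x)))" if "k \<in> scalars TYPE('a)" "x \<in> dom ?H" for k x
      unfolding form_operator_eq_Some
      using weak[OF that(2)] that(1)
      by (simp add: dom_form_closed[OF pos] polar_scaleK[OF pos] ip_scaleK)
    have "dom ?H \<noteq> {}" using dense_dom_form_operator by auto
    then obtain x where x: "x \<in> dom ?H" by blast
    have "?H (scaleK (of_real 0) x) = Some (scaleK (of_real 0) (the (?H x)))"
      by (rule sc[OF of_real_in_scalars x])
    then have "0 \<in> dom ?H" unfolding scaleK_of_real by auto
    then show ?thesis unfolding linear_operator_def subspaceK_def
      using add sc by (auto simp: domI)
  qed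
  show "adjoint_operator ?H = ?H"
  proof
    have sym: "ip (the (?H u)) v = ip u w" if "?H v = Some w" "u \<in> dom ?H" for u v w
    proof -
      have v: "v \<in> dom ?H" using that(1) by blast
      have "ip (the (?H u)) v = cnj (polar c v u)"
        using weak(2)[OF that(2) weak(1)[OF v]] polar_commute[OF pos weak(1)[OF v] weak(1)[OF that(2)]]
        by simp
      also have "\<dots> = ip u w"
        using weak(2)[OF v weak(1)[OF that(2)]] that(1) ip_commute[of u w] by simp
      finally show ?thesis .
    qed
    fix v
    have uniq: "w = w'"
      if "\<forall>u\<in>dom ?H. ip (the (?H u)) v = ip u w" "\<forall>u\<in>dom ?H. ip (the (?H u)) v = ip u w'" for w w'
    proof (rule ip_eq_on_dense[OF dense_dom_form_operator])
      fix u assume "u \<in> dom ?H"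
      then have "ip u w = ip u w'" using that by simp
      then show "ip w u = ip w' u" using ip_commute[of w u] ip_commute[of w' u] by simp
    qed
    have onto: "?H v = Some w" if w: "\<forall>u\<in>dom ?H. ip (the (?H u)) v = ip u w" for w
    proof -
      define v' where "v' = inverse_plus_one ?H (w + v)"
      have v': "?H v' = Some (w + v - v')"
        unfolding form_operator_eq_Some using inverse_plus_one_form_operator[of "w + v" v'] v'_def by simp
      have "v = v'"
      proof (rule ip_eq_on_dense[of UNIV])
        fix f
        define u where "u = inverse_plus_one ?H f"
        have "?H u = Some (f - u)"
          unfolding form_operator_eq_Some using inverse_plus_one_form_operator[of f u] u_def by simp
        then have u: "u \<in> dom ?H" and Hu: "the (?H u) = f - u" by auto
        have "ip (f - u) v = ip u w" using w u Hu by metis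
        moreover have "ip (f - u) v' = ip u (w + v - v')"
          using sym[OF v' u] Hu by simp
        ultimately have "ip f v = ip f v'" by (simp add: ip_diff ip_diff_right ip_add_right algebra_simps)
        then show "ip v f = ip v' f" using ip_commute[of v f] ip_commute[of v' f] by simp
      qed simp
      then show ?thesis using v' by simp
    qed
    show "adjoint_operator ?H v = ?H v"
    proof (cases "\<exists>w. \<forall>u\<in>dom ?H. ip (the (?H u)) v = ip u w")
      case True
      then obtain w where w: "\<forall>u\<in>dom ?H. ip (the (?H u)) v = ip u w" by blast
      then have "(THE w. \<forall>u\<in>dom ?H. ip (the (?H u)) v = ip u w) = w"
        using uniq by (intro the_equality) blast+
      then show ?thesis unfolding adjoint_operator_def using True onto[OF w] by simp
    next
      case False
      then have "?H v = None" using sym by (metis not_None_eq)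
      then show ?thesis unfolding adjoint_operator_def using False by simp
    qed
  qed
  fix u assume u: "u \<in> dom ?H"
  have "ip (the (?H u)) u = of_real (the (c u))"
    using weak(2)[OF u weak(1)[OF u]] polar_self[OF pos weak(1)[OF u]] by simp
  then show "0 \<le> Re (ip (the (?H u)) u)" using form_nonneg[OF pos weak(1)[OF u]] by simp
qed

end

text \<open>On the domain of the common operator the forms agree; the approximation by such vectors and
  the lower semicontinuity of closed forms extend this to both form domains.\<close>

lemma closed_form_eq_if_form_operator_eq:
  assumes c: "closed_form c" "closure (dom c) = UNIV" and c': "closed_form c'" "closure (dom c') = UNIV"
    and eq: "form_operator c = form_operator c'"
  shows "c = c'"
proof -
  have le: "x \<in> dom c' \<and> the (c' x) \<le> the (c x)"
    if c: "closed_form c" "closure (dom c) = UNIV" and c': "closed_form c'" "closure (dom c') = UNIV"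
      and eq: "form_operator c = form_operator c'" and x: "x \<in> dom c" for c c' and x :: 'a
  proof -
    obtain u where u: "\<And>n. u n \<in> dom (form_operator c)" "u \<longlonglongrightarrow> x" "\<And>n. the (c (u n)) \<le> the (c x)"
      using form_operator_approximation[OF c x] by blast
    have same: "w \<in> dom c' \<and> the (c w) = the (c' w)" if w: "w \<in> dom (form_operator c)" for w
    proof -
      obtain f where f: "form_operator c w = Some f" using w by blast
      then have f': "form_operator c' w = Some f" by (simp only: eq)
      have "w \<in> dom c" "w \<in> dom c'" "polar c w w = polar c' w w"
        using f f' unfolding form_operator_eq_Some[OF c] form_operator_eq_Some[OF c'] by auto
      then show ?thesis
        by (simp add: polar_self[OF positive_if_closed[OF c(1)]] polar_self[OF positive_if_closed[OF c'(1)]])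
    qed
    have "relaxed_bound c' x (the (c x))"
    proof (rule relaxed_boundI[OF _ u(2)])
      show "u n \<in> dom c'" for n using same u(1) by blast
      fix e :: real assume "0 < e"
      then have "the (c' (u n)) < the (c x) + e" for n using same[OF u(1)[of n]] u(3)[of n] by linarith
      then show "\<exists>\<^sub>F n in sequentially. the (c' (u n)) < the (c x) + e"
        by (simp add: eventually_frequently)
    qed
    from relaxation_le[OF positive_if_closed[OF c'(1)] this] show ?thesis
      by (simp add: relaxation_of_closed[OF c'(1)])
  qed
  have 1: "x \<in> dom c' \<and> the (c' x) \<le> the (c x)" if "x \<in> dom c" for x
    by (rule le[OF assms that])
  have 2: "x \<in> dom c \<and> the (c x) \<le> the (c' x)" if "x \<in> dom c'" for x
    by (rule le[OF c' c eq[symmetric] that])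
  show ?thesis
  proof
    fix x
    show "c x = c' x"
    proof (cases "x \<in> dom c")
      case True
      then have "x \<in> dom c'" "the (c x) = the (c' x)" using 1[OF True] 2[of x] by auto
      then show ?thesis using True by (auto intro: option.expand)
    next
      case False
      then have "x \<notin> dom c'" using 2 by blast
      then show ?thesis using False unfolding domIff by simp
    qed
  qed
qed

text \<open>The operator is recovered from its resolvent: \<open>H u = w\<close> says that the resolvent maps
  \<open>w + u\<close> to \<open>u\<close>.\<close>

lemma closed_form_eq_if_resolvent_eq:
  assumes c: "closed_form c" "closure (dom c) = UNIV" and c': "closed_form c'" "closure (dom c') = UNIV"
    and eq: "\<And>f. inverse_plus_one (form_operator c) f = inverse_plus_one (form_operator c') f"
  shows "c = c'"
proof (rule closed_form_eq_if_form_operator_eq[OF c c'])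
  have Some_iff: "form_operator b u = Some w \<longleftrightarrow> inverse_plus_one (form_operator b) (w + u) = u"
    if b: "closed_form b" "closure (dom b) = UNIV" for b and u w :: 'a
    unfolding form_operator_eq_Some[OF b] inverse_plus_one_form_operator[OF b] by simp
  have "form_operator c u = Some w \<longleftrightarrow> form_operator c' u = Some w" for u w
    unfolding Some_iff[OF c] Some_iff[OF c'] eq ..
  then show "form_operator c = form_operator c'" by (intro ext) (metis option.exhaust)
qed

text \<open>Let \<open>m\<close> be the minimum of \<open>c[v] + \<parallel>v - f\<parallel>\<^sup>2\<close> for the relaxation \<open>c\<close> of \<open>q\<close>, let \<open>u\<close> be its minimizer,
  and let \<open>m a\<close> and \<open>u a\<close> be those for \<open>qs a\<close>. Since \<open>c \<le> q \<le> qs a\<close>, inserting \<open>u a\<close> into the functional of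
  \<open>c\<close> gives \<open>\<parallel>u a - u\<parallel>\<^sup>2 \<le> m a - m\<close>. A recovery sequence for \<open>u\<close>, together with \<open>qs a \<longlonglongrightarrow> q\<close>,
  shows \<open>m a \<longlonglongrightarrow> m\<close>.\<close>

lemma resolvent_convergence_from_above:
  fixes q :: "'a::hilbert_space \<rightharpoonup> real"
  assumes q: "positive_form q" and dense: "closure (dom q) = UNIV"
    and qs: "\<forall>\<^sub>F a in F. closed_form (qs a) \<and> dom (qs a) = dom q \<and> (\<forall>y\<in>dom q. the (q y) \<le> the (qs a y))"
    and lim: "\<And>y. y \<in> dom q \<Longrightarrow> ((\<lambda>a. the (qs a y)) \<longlongrightarrow> the (q y)) F"
  shows "((\<lambda>a. inverse_plus_one (form_operator (qs a)) f)
    \<longlongrightarrow> inverse_plus_one (form_operator (relaxation q)) f) F"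
proof (rule tendstoI)
  let ?c = "relaxation q" and ?u = "inverse_plus_one (form_operator (relaxation q)) f"
  let ?ua = "\<lambda>a. inverse_plus_one (form_operator (qs a)) f"
  let ?m = "the (?c ?u) + (norm (?u - f))\<^sup>2"
  fix e :: real assume e: "0 < e"
  have c: "closed_form ?c" "closure (dom ?c) = UNIV" "positive_form ?c"
    using relaxation_closed[OF q] dense_dom_relaxation[OF q dense] relaxation_positive[OF q] by blast+
  have u: "?u \<in> dom ?c" "\<And>v. v \<in> dom ?c \<Longrightarrow> polar ?c ?u v = ip (f - ?u) v"
    using inverse_plus_one_form_operator[OF c(1,2), of f ?u] by blast+
  obtain w where "recovery_sequence q w ?u" using recovery_sequence_exists[OF q u(1)] by blast
  then have w: "\<And>n. w n \<in> dom q" "w \<longlonglongrightarrow> ?u" "(\<lambda>n. the (q (w n))) \<longlonglongrightarrow> the (?c ?u)"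
    unfolding recovery_sequence_def by blast+
  have "(\<lambda>n. the (q (w n)) + (norm (w n - f))\<^sup>2) \<longlonglongrightarrow> ?m"
    by (intro tendsto_intros w)
  then have "\<forall>\<^sub>F n in sequentially. the (q (w n)) + (norm (w n - f))\<^sup>2 < ?m + e\<^sup>2"
    using e by (intro order_tendstoD(2)) auto
  then obtain n where n: "the (q (w n)) + (norm (w n - f))\<^sup>2 < ?m + e\<^sup>2"
    using eventually_happens' sequentially_bot by blast
  have "((\<lambda>a. the (qs a (w n)) + (norm (w n - f))\<^sup>2) \<longlongrightarrow> the (q (w n)) + (norm (w n - f))\<^sup>2) F"
    by (intro tendsto_intros lim w)
  then have "\<forall>\<^sub>F a in F. the (qs a (w n)) + (norm (w n - f))\<^sup>2 < ?m + e\<^sup>2"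
    using n by (rule order_tendstoD(2))
  with qs show "\<forall>\<^sub>F a in F. dist (?ua a) ?u < e"
  proof eventually_elim
    case (elim a)
    then have b: "closed_form (qs a)" "closure (dom (qs a)) = UNIV" "positive_form (qs a)"
      and dom: "dom (qs a) = dom q" and ge: "\<And>y. y \<in> dom q \<Longrightarrow> the (q y) \<le> the (qs a y)"
      using dense positive_if_closed by auto
    have ua: "?ua a \<in> dom (qs a)" "\<And>v. v \<in> dom (qs a) \<Longrightarrow> polar (qs a) (?ua a) v = ip (f - ?ua a) v"
      using inverse_plus_one_form_operator[OF b(1,2), of f "?ua a"] by blast+
    have uq: "?ua a \<in> dom q" using ua(1) dom by simp
    have uc: "?ua a \<in> dom ?c" by (rule relaxation_below(1)[OF q uq])
    have "?m + (norm (?ua a - ?u))\<^sup>2 \<le> the (?c (?ua a)) + (norm (?ua a - f))\<^sup>2"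
      using resolvent_minimizes[OF c(3) u uc] form_nonneg[OF c(3) dom_form_closed(3)[OF c(3) uc u(1)]] by simp
    also have "\<dots> \<le> the (qs a (?ua a)) + (norm (?ua a - f))\<^sup>2"
      using relaxation_below(2)[OF q uq] ge[OF uq] by simp
    also have "\<dots> \<le> the (qs a (w n)) + (norm (w n - f))\<^sup>2"
    proof -
      have wn: "w n \<in> dom (qs a)" using w(1) dom by simp
      show ?thesis
        using resolvent_minimizes[OF b(3) ua wn] form_nonneg[OF b(3) dom_form_closed(3)[OF b(3) wn ua(1)]]
        by simp
    qed
    finally have "(norm (?ua a - ?u))\<^sup>2 < e\<^sup>2" using elim(2) by simp
    then show ?case using e by (simp add: dist_norm power2_less_imp_less)
  qed
qed


section \<open>Quotient forms\<close>

lemma linear_operator_rules: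
  fixes J :: "'a::hilbert_space \<rightharpoonup> 'b::hilbert_space"
  assumes J: "linear_operator J"
  shows "J x = Some a \<Longrightarrow> J y = Some b \<Longrightarrow> J (x + y) = Some (a + b)"
    and "J x = Some a \<Longrightarrow> J y = Some b \<Longrightarrow> J (x - y) = Some (a - b)"
    and "J x = Some a \<Longrightarrow> c \<in> scalars TYPE('a) \<Longrightarrow> J (scaleK c x) = Some (scaleK c a)"
proof -
  have sub: "subspaceK (dom J)" using J unfolding linear_operator_def by blast
  have add: "J (x + y) = Some (a + b)" if "J x = Some a" "J y = Some b" for x y a b
  proof -
    have d: "x \<in> dom J" "y \<in> dom J" using that by blast+
    then have "the (J (x + y)) = a + b" using J that unfolding linear_operator_def by simp
    then show ?thesis using subspaceK_closed(2)[OF sub d] by auto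
  qed
  show "J (x + y) = Some (a + b)" if "J x = Some a" "J y = Some b" by (rule add[OF that])
  show "J (x - y) = Some (a - b)" if x: "J x = Some a" and y: "J y = Some b"
  proof -
    have "x - y \<in> dom J" using subspaceK_closed(3)[OF sub] x y by blast
    then obtain e where e: "J (x - y) = Some e" by blast
    have "J x = Some (e + b)" using add[OF e y] by simp
    then show ?thesis using e x by simp
  qed
  show "J (scaleK c x) = Some (scaleK c a)" if x: "J x = Some a" and c: "c \<in> scalars TYPE('a)"
  proof -
    have d: "x \<in> dom J" using x by blast
    then have "the (J (scaleK c x)) = scaleK c a" using J x c unfolding linear_operator_def by simp
    then show ?thesis using subspaceK_closed(5)[OF sub c d] by auto
  qed
qed

lemma linear_operator_zero:
  assumes "linear_operator J"
  shows "J 0 = Some 0"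
proof -
  have "0 \<in> dom J" using assms subspaceK_closed(1) unfolding linear_operator_def by blast
  then obtain a where "J 0 = Some a" by blast
  then show ?thesis using linear_operator_rules(2)[OF assms, of 0 a 0 a] by simp
qed

lemma subspaceK_null_space:
  fixes J :: "'a::hilbert_space \<rightharpoonup> 'b::hilbert_space"
  assumes J: "linear_operator J" and sc: "scalars TYPE('b) = scalars TYPE('a)"
  shows "subspaceK (null_space J)"
proof -
  have "scaleK c (0::'b) = 0" if "c \<in> scalars TYPE('a)" for c
    using norm_scaleK[of c "0::'b"] that sc by simp
  then show ?thesis
    unfolding subspaceK_def null_space_def
    using linear_operator_rules(1,3)[OF J] linear_operator_zero[OF J] by fastforce
qed

lemma null_space_subset: "null_space J \<subseteq> dom J"
  unfolding null_space_def by blast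

text \<open>Orthogonality to the kernel is the Euler equation for least energy among all preimages of \<open>y\<close>.\<close>

definition minimal_representative ::
    "('a::hilbert_space \<rightharpoonup> real) \<Rightarrow> ('a \<rightharpoonup> 'b::hilbert_space) \<Rightarrow> 'b \<Rightarrow> 'a \<Rightarrow> bool" where
  "minimal_representative p J y u \<longleftrightarrow> J u = Some y \<and> (\<forall>v\<in>null_space J. polar p u v = 0)"

text \<open>The form induced by \<open>p\<close> on \<open>dom J / ker J\<close>, carried over to the range of \<open>J\<close>. The representative
  orthogonal to the kernel is postulated rather than constructed by a projection, since the
  projections live in different spaces for the forms under consideration.\<close>

definition quotient_form ::
    "('a::hilbert_space \<rightharpoonup> real) \<Rightarrow> ('a \<rightharpoonup> 'b::hilbert_space) \<Rightarrow> ('b \<rightharpoonup> real) \<Rightarrow> bool" where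
  "quotient_form p J R \<longleftrightarrow> dom R = ran J \<and>
     (\<forall>y\<in>ran J. \<exists>u. minimal_representative p J y u \<and> R y = Some (the (p u)))"

lemma minimal_representative_exists:
  assumes "quotient_form p J R" "y \<in> ran J"
  shows "\<exists>u. minimal_representative p J y u \<and> R y = Some (the (p u))"
  using assms unfolding quotient_form_def by blast

context
  fixes p :: "'a::hilbert_space \<rightharpoonup> real" and J :: "'a \<rightharpoonup> 'b::hilbert_space" and R :: "'b \<rightharpoonup> real"
  assumes p: "positive_form p" and J: "linear_operator J" and J_dom: "dom J \<subseteq> dom p"
    and R: "quotient_form p J R"
begin

private lemma J_Some_dom: "J u = Some y \<Longrightarrow> u \<in> dom p"
  using J_dom by blast

lemma minimal_representative_le:
  assumes u: "minimal_representative p J y u" and w: "J w = Some y"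
  shows "the (p u) \<le> the (p w)"
proof -
  have Ju: "J u = Some y" and ortho: "\<And>v. v \<in> null_space J \<Longrightarrow> polar p u v = 0"
    using u unfolding minimal_representative_def by blast+
  have d: "u \<in> dom p" "w \<in> dom p" using J_Some_dom Ju w by blast+
  have wu: "w - u \<in> dom p" by (rule dom_form_closed(3)[OF p d(2,1)])
  have "w - u \<in> null_space J"
    using linear_operator_rules(2)[OF J w Ju] unfolding null_space_def by simp
  then have "the (p w) = the (p u) + the (p (w - u))"
    using form_add[OF p d(1) wu] ortho[of "w - u"] by simp
  then show ?thesis using form_nonneg[OF p wu] by simp
qed

lemma quotient_form_value:
  assumes u: "minimal_representative p J y u"
  shows "the (R y) = the (p u)"
proof -
  have Ju: "J u = Some y" using u unfolding minimal_representative_def by blast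
  then obtain u' where u': "minimal_representative p J y u'" "R y = Some (the (p u'))"
    using minimal_representative_exists[OF R ranI] by blast
  then have "J u' = Some y" unfolding minimal_representative_def by blast
  then show ?thesis
    using u'(2) minimal_representative_le[OF u] minimal_representative_le[OF u'(1) Ju] by fastforce
qed

lemma quotient_form_le:
  assumes w: "J w = Some y"
  shows "the (R y) \<le> the (p w)"
proof -
  obtain u where "minimal_representative p J y u" "R y = Some (the (p u))"
    using minimal_representative_exists[OF R ranI] w by blast
  then show ?thesis using minimal_representative_le[OF _ w] by simp
qed

lemma minimal_representative_linear:
  assumes "minimal_representative p J y u" "minimal_representative p J z v"
  shows "minimal_representative p J (y + z) (u + v)" "minimal_representative p J (y - z) (u - v)"
    "c \<in> scalars TYPE('a) \<Longrightarrow> minimal_representative p J (scaleK c y) (scaleK c u)"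
proof -
  have Ju: "J u = Some y" and Jv: "J v = Some z" using assms unfolding minimal_representative_def by blast+
  have d: "u \<in> dom p" "v \<in> dom p" using J_Some_dom Ju Jv by blast+
  have n: "w \<in> dom p" if "w \<in> null_space J" for w
    using subsetD[OF order_trans[OF null_space_subset J_dom] that] .
  show "minimal_representative p J (y + z) (u + v)" "minimal_representative p J (y - z) (u - v)"
    using assms linear_operator_rules(1,2)[OF J Ju Jv] polar_add[OF p d n] polar_diff[OF p d n]
    unfolding minimal_representative_def by simp_all
  show "minimal_representative p J (scaleK c y) (scaleK c u)" if c: "c \<in> scalars TYPE('a)"
    using assms(1) linear_operator_rules(3)[OF J Ju c] polar_scaleK[OF p c d(1) n]
    unfolding minimal_representative_def by simp
qed

text \<open>Two minimal representatives of \<open>y\<close> may differ where \<open>p\<close> is degenerate, but only by a kernel element,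
  to which \<open>w\<close> is orthogonal.\<close>

lemma polar_minimal_representative_cong:
  assumes "minimal_representative p J y u" "minimal_representative p J y u'"
    and w: "minimal_representative p J z w"
  shows "polar p u w = polar p u' w"
proof -
  have Ju: "J u = Some y" "J u' = Some y" "J w = Some z"
    using assms unfolding minimal_representative_def by blast+
  have d: "u \<in> dom p" "u' \<in> dom p" "w \<in> dom p" using J_Some_dom Ju by blast+
  have diff: "u - u' \<in> dom p" by (rule dom_form_closed(3)[OF p d(1,2)])
  have "u - u' \<in> null_space J"
    using linear_operator_rules(2)[OF J Ju(1,2)] unfolding null_space_def by simp
  then have "polar p w (u - u') = 0" using w unfolding minimal_representative_def by blast
  then show ?thesis using polar_commute[OF p d(3) diff] polar_diff[OF p d] by simp
qed

lemma quotient_form_positive: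
  assumes scalars_eq: "scalars TYPE('b) = scalars TYPE('a)"
  shows "positive_form R"
proof -
  have dom_R: "dom R = ran J" using R unfolding quotient_form_def by blast
  obtain g where g: "\<And>y. y \<in> ran J \<Longrightarrow> minimal_representative p J y (g y)"
    using minimal_representative_exists[OF R] by metis
  have gd: "g y \<in> dom p" if "y \<in> ran J" for y
    using g[OF that] J_Some_dom unfolding minimal_representative_def by blast
  have gr: "y \<in> ran J" if "minimal_representative p J y u" for y u
    using that unfolding minimal_representative_def by (blast intro: ranI)
  have sub: "subspaceK (ran J)"
    unfolding subspaceK_def scalars_eq
  proof (intro conjI ballI)
    show "0 \<in> ran J" using linear_operator_zero[OF J] by (rule ranI)
    show "x + y \<in> ran J" if "x \<in> ran J" "y \<in> ran J" for x y
      by (rule gr[OF minimal_representative_linear(1)[OF g[OF that(1)] g[OF that(2)]]])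
    show "scaleK c x \<in> ran J" if "c \<in> scalars TYPE('a)" "x \<in> ran J" for c x
      by (rule gr[OF minimal_representative_linear(3)[OF g[OF that(2)] g[OF that(2)] that(1)]])
  qed
  note cl = subspaceK_closed[OF sub]
  have "symmetric_sesquilinear_on (ran J) (\<lambda>y z. polar p (g y) (g z))"
    unfolding symmetric_sesquilinear_on_def scalars_eq
  proof (intro conjI ballI)
    fix x y z c assume d: "x \<in> ran J" "y \<in> ran J"
    show "polar p (g x) (g y) \<in> scalars TYPE('a)" by (rule polar_in_scalars)
    show "polar p (g y) (g x) = cnj (polar p (g x) (g y))"
      by (rule polar_commute[OF p gd[OF d(1)] gd[OF d(2)]])
    show "polar p (g (x + y)) (g z) = polar p (g x) (g z) + polar p (g y) (g z)" if z: "z \<in> ran J"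
    proof -
      have "polar p (g (x + y)) (g z) = polar p (g x + g y) (g z)"
        by (rule polar_minimal_representative_cong[OF g minimal_representative_linear(1)[OF g g] g])
          (intro cl d z)+
      then show ?thesis using polar_add[OF p gd[OF d(1)] gd[OF d(2)] gd[OF z]] by simp
    qed
    show "polar p (g (scaleK c x)) (g y) = c * polar p (g x) (g y)" if c: "c \<in> scalars TYPE('a)"
    proof -
      have "polar p (g (scaleK c x)) (g y) = polar p (scaleK c (g x)) (g y)"
        by (rule polar_minimal_representative_cong[OF g minimal_representative_linear(3)[OF g g c] g])
          (use c d scalars_eq cl(5) in auto)
      then show ?thesis using polar_scaleK[OF p c gd[OF d(1)] gd[OF d(2)]] by simp
    qed
  qed
  moreover have "polar p (g y) (g y) = of_real (the (R y)) \<and> 0 \<le> the (R y)" if y: "y \<in> ran J" for y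
    unfolding quotient_form_value[OF g[OF y]]
    using polar_self[OF p gd[OF y]] form_nonneg[OF p gd[OF y]] by blast
  ultimately show ?thesis unfolding positive_form_def dom_R using sub by blast
qed

text \<open>Minimal representatives of a Cauchy sequence are Cauchy with the same distances, and any
  preimage of the limit bounds the quotient form from above.\<close>

lemma quotient_form_closed:
  assumes scalars_eq: "scalars TYPE('b) = scalars TYPE('a)"
    and J_closed: "\<And>u y. (\<forall>n. u n \<in> dom J) \<Longrightarrow> form_Cauchy p u \<Longrightarrow> (\<lambda>n. the (J (u n))) \<longlonglongrightarrow> y \<Longrightarrow>
      \<exists>x. J x = Some y \<and> form_tendsto p u x"
  shows "closed_form R"
  unfolding closed_form_def
proof (intro conjI allI impI)
  show R_pos: "positive_form R" by (rule quotient_form_positive[OF scalars_eq])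
  have dom_R: "dom R = ran J" using R unfolding quotient_form_def by blast
  fix y assume "form_Cauchy (form_plus R 1) y"
  then have C: "form_Cauchy R y" "Cauchy y"
    using form_Cauchy_plus[OF R_pos, of 1] by simp_all
  then have yr: "y n \<in> ran J" for n unfolding form_Cauchy_def dom_R by blast
  obtain z where yz: "y \<longlonglongrightarrow> z" using C(2) Cauchy_convergent convergentD by blast
  obtain u where u: "\<And>n. minimal_representative p J (y n) (u n)"
    using minimal_representative_exists[OF R yr] by metis
  then have Ju: "J (u n) = Some (y n)" for n unfolding minimal_representative_def by blast
  have "form_Cauchy p u"
    using C(1) J_Some_dom[OF Ju] unfolding form_Cauchy_def
    by (simp add: quotient_form_value[OF minimal_representative_linear(2)[OF u u]])
  moreover have "(\<lambda>n. the (J (u n))) \<longlonglongrightarrow> z" using yz by (simp add: Ju)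
  ultimately obtain x where x: "J x = Some z" "form_tendsto p u x"
    using J_closed[of u z] Ju by blast
  have zr: "z \<in> dom R" unfolding dom_R using x(1) by (rule ranI)
  have "(\<lambda>n. the (R (y n - z))) \<longlonglongrightarrow> 0"
  proof (rule Lim_null_comparison)
    show "(\<lambda>n. the (p (u n - x))) \<longlonglongrightarrow> 0" using x(2) unfolding form_tendsto_def by blast
    have "y n - z \<in> dom R" for n
      using dom_form_closed(3)[OF R_pos _ zr] yr dom_R by blast
    then have "norm (the (R (y n - z))) \<le> the (p (u n - x))" for n
      using quotient_form_le[OF linear_operator_rules(2)[OF J Ju x(1)]]
        form_nonneg[OF R_pos] by simp
    then show "\<forall>\<^sub>F n in sequentially. norm (the (R (y n - z))) \<le> the (p (u n - x))" by simp
  qed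
  then have "form_tendsto R y z" unfolding form_tendsto_def using yr zr dom_R by blast
  then show "\<exists>x. form_tendsto (form_plus R 1) y x"
    using yz form_tendsto_plus[OF R_pos, of 1] by auto
qed

end


section \<open>Traces\<close>

lemma closed_operator_limit:
  assumes E: "closed_form E" and J_closed: "closed_operator_wrt (form_plus E 1) J" and a: "0 < a"
    and u: "\<forall>n. u n \<in> dom J" and C: "form_Cauchy (form_plus E a) u" and lim: "(\<lambda>n. the (J (u n))) \<longlonglongrightarrow> y"
  shows "\<exists>x. J x = Some y \<and> form_tendsto (form_plus E a) u x"
proof -
  note pos = positive_if_closed[OF E]
  have "form_Cauchy E u" "Cauchy u" using C form_Cauchy_plus[OF pos a] by blast+
  then obtain x where x: "form_tendsto E u x" "u \<longlonglongrightarrow> x" by (rule closed_form_complete[OF E])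
  then have "form_tendsto (form_plus E 1) u x" "form_tendsto (form_plus E a) u x"
    using form_tendsto_plus[OF pos] a by auto
  then show ?thesis using J_closed u lim unfolding closed_operator_wrt_def by blast
qed

lemma trace_approx_quotient_form:
  fixes E :: "'a::hilbert_space \<rightharpoonup> real" and J :: "'a \<rightharpoonup> 'b::hilbert_space"
  assumes E: "closed_form E" and J: "linear_operator J" and J_dom: "dom J \<subseteq> dom E"
    and J_closed: "closed_operator_wrt (form_plus E 1) J"
    and sc: "scalars TYPE('b) = scalars TYPE('a)" and a: "0 < a"
  shows "quotient_form (form_plus E a) J (trace_approx E J a)"
  unfolding quotient_form_def
proof (intro conjI ballI)
  show "dom (trace_approx E J a) = ran J"
    unfolding trace_approx_def dom_def by auto
  fix y assume y: "y \<in> ran J"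
  note pos = positive_if_closed[OF E]
  let ?p = "form_plus E a" and ?N = "null_space J"
  have p: "positive_form ?p" using form_plus_positive[OF pos] a by simp
  define u where "u = (SOME u. J u = Some y)"
  have "\<exists>u. J u = Some y" using y unfolding ran_def by blast
  then have Ju: "J u = Some y" unfolding u_def by (rule someI_ex)
  then have u: "u \<in> dom E" using J_dom by blast
  have N: "?N \<subseteq> dom E" by (rule order_trans[OF null_space_subset J_dom])
  have "\<exists>k\<in>?N. \<forall>v\<in>?N. polar ?p (u - k) v = 0"
  proof (rule orthogonal_decomposition[OF p subspaceK_null_space[OF J sc]])
    fix w assume w: "\<forall>n. w n \<in> ?N" "form_Cauchy ?p w"
    then have "(\<lambda>n. the (J (w n))) \<longlonglongrightarrow> 0" unfolding null_space_def by simp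
    then show "\<exists>x\<in>?N. form_tendsto ?p w x"
      using closed_operator_limit[OF E J_closed a _ w(2)] w(1) unfolding null_space_def by blast
  qed (use N u in simp_all)
  then obtain k where k: "k \<in> ?N" "\<And>v. v \<in> ?N \<Longrightarrow> polar ?p (u - k) v = 0" by blast
  have "trace_projection E J a u = u - k"
    unfolding trace_projection_def Let_def
  proof (rule ortho_projection_eq[OF _ dom_subspace[OF pos] _ k(1) N u])
    show "polar ?p (u - k) v = 0" if "v \<in> ?N" for v by (rule k(2)[OF that])
    show "symmetric_sesquilinear_on (dom E) (polar ?p)" using polar_sesquilinear[OF p] by simp
    fix x assume x: "x \<in> dom E" "polar ?p x x = 0"
    then have "the (E x) + a * (norm x)\<^sup>2 = 0"
      using polar_self[OF p, of x] by (simp add: the_form_plus flip: of_real_mult of_real_add of_real_power)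
    moreover have "0 \<le> a * (norm x)\<^sup>2" using a by simp
    ultimately have "a * (norm x)\<^sup>2 = 0" using form_nonneg[OF pos x(1)] by linarith
    then show "x = 0" using a by simp
  qed
  moreover have "minimal_representative ?p J y (u - k)"
    using linear_operator_rules(2)[OF J Ju, of k 0] k unfolding minimal_representative_def null_space_def by simp
  ultimately show "\<exists>u. minimal_representative ?p J y u \<and> trace_approx E J a y = Some (the (?p u))"
    using y unfolding trace_approx_def u_def[symmetric] by auto
qed

text \<open>The two estimates behind the convergence: minimizing the larger form costs more, and the
  minimizer of \<open>E\<close> is admissible for \<open>form_plus E a\<close>, where it costs only \<open>a\<close> times its squared norm more.\<close>

lemma quotient_form_shift_limit:
  assumes E: "positive_form E" and J: "linear_operator J" and J_dom: "dom J \<subseteq> dom E"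
    and Q: "quotient_form E J Q"
    and R: "\<And>a. 0 < a \<Longrightarrow> quotient_form (form_plus E a) J (R a)" and y: "y \<in> ran J"
  shows "0 < a \<Longrightarrow> the (Q y) \<le> the (R a y)"
    and "((\<lambda>a. the (R a y)) \<longlongrightarrow> the (Q y)) (at_right 0)"
proof -
  have dom': "dom J \<subseteq> dom (form_plus E a)" for a using J_dom by simp
  have p: "positive_form (form_plus E a)" if "0 < a" for a using form_plus_positive[OF E] that by simp
  have lower: "the (Q y) \<le> the (R a y)" if a: "0 < a" for a
  proof -
    obtain u where u: "minimal_representative (form_plus E a) J y u" "R a y = Some (the (form_plus E a u))"
      using minimal_representative_exists[OF R[OF a] y] by blast
    then have Ju: "J u = Some y" unfolding minimal_representative_def by blast
    have "the (Q y) \<le> the (E u)" by (rule quotient_form_le[OF E J J_dom Q Ju])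
    also have "\<dots> \<le> the (R a y)"
      using u(2) a Ju J_dom the_form_plus[of u E a] by (auto simp: domI subset_iff)
    finally show ?thesis .
  qed
  show "0 < a \<Longrightarrow> the (Q y) \<le> the (R a y)" by (rule lower)
  obtain u where u: "minimal_representative E J y u" "Q y = Some (the (E u))"
    using minimal_representative_exists[OF Q y] by blast
  then have Ju: "J u = Some y" and uE: "u \<in> dom E"
    using J_dom unfolding minimal_representative_def by blast+
  have upper: "the (R a y) \<le> the (Q y) + a * (norm u)\<^sup>2" if a: "0 < a" for a
    using quotient_form_le[OF p[OF a] J dom' R[OF a] Ju] u(2) by (simp add: the_form_plus[OF uE])
  have pos_ev: "\<forall>\<^sub>F a in at_right (0::real). 0 < a" by (rule eventually_at_right_less)
  show "((\<lambda>a. the (R a y)) \<longlongrightarrow> the (Q y)) (at_right 0)"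
  proof (rule tendsto_sandwich)
    show "\<forall>\<^sub>F a in at_right 0. the (Q y) \<le> the (R a y)"
      using pos_ev by eventually_elim (rule lower)
    show "\<forall>\<^sub>F a in at_right 0. the (R a y) \<le> the (Q y) + a * (norm u)\<^sup>2"
      using pos_ev by eventually_elim (rule upper)
    have "((\<lambda>a. the (Q y) + a * (norm u)\<^sup>2) \<longlongrightarrow> the (Q y) + 0 * (norm u)\<^sup>2) (at_right 0)"
      by (intro tendsto_intros)
    then show "((\<lambda>a. the (Q y) + a * (norm u)\<^sup>2) \<longlongrightarrow> the (Q y)) (at_right 0)" by simp
  qed simp
qed

lemma form_completion_rules:
  fixes E :: "'a::hilbert_space \<rightharpoonup> real" and \<iota> :: "'a \<Rightarrow> 'c::hilbert_space"
  assumes \<iota>: "form_completion E \<iota>" and E: "positive_form E" and u: "u \<in> dom E" and v: "v \<in> dom E"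
  shows "\<iota> (u - v) = \<iota> u - \<iota> v" "(norm (\<iota> u))\<^sup>2 = the (E u)" "ip (\<iota> u) (\<iota> v) = polar E u v"
proof -
  have add: "\<iota> (x + y) = \<iota> x + \<iota> y" if "x \<in> dom E" "y \<in> dom E" for x y
    using \<iota> that unfolding form_completion_def by blast
  have ip: "ip (\<iota> x) (\<iota> y) = polar E x y" if "x \<in> dom E" "y \<in> dom E" for x y
    using \<iota> that unfolding form_completion_def by blast
  show "\<iota> (u - v) = \<iota> u - \<iota> v" using add[OF dom_form_closed(3)[OF E u v] v] by (simp add: algebra_simps)
  show "ip (\<iota> u) (\<iota> v) = polar E u v" by (rule ip[OF u v])
  have "complex_of_real ((norm (\<iota> u))\<^sup>2) = of_real (the (E u))"
    unfolding ip_self[symmetric] ip[OF u u] polar_self[OF E u] ..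
  then show "(norm (\<iota> u))\<^sup>2 = the (E u)" unfolding of_real_eq_iff .
qed

lemma form_completion_Cauchy:
  fixes E :: "'a::hilbert_space \<rightharpoonup> real" and \<iota> :: "'a \<Rightarrow> 'c::hilbert_space"
  assumes \<iota>: "form_completion E \<iota>" and E: "positive_form E" and C: "form_Cauchy E u"
  shows "Cauchy (\<lambda>n. \<iota> (u n))"
proof (rule CauchyI)
  have u: "\<And>n. u n \<in> dom E" using C unfolding form_Cauchy_def by blast
  fix e :: real assume e: "0 < e"
  then have "0 < e\<^sup>2" by simp
  then obtain N where N: "\<And>m n. m \<ge> N \<Longrightarrow> n \<ge> N \<Longrightarrow> the (E (u m - u n)) < e\<^sup>2"
    using C unfolding form_Cauchy_def by meson
  have "norm (\<iota> (u m) - \<iota> (u n)) < e" if "m \<ge> N" "n \<ge> N" for m n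
  proof -
    have d: "u m - u n \<in> dom E" by (rule dom_form_closed(3)[OF E u u])
    have "(norm (\<iota> (u m - u n)))\<^sup>2 < e\<^sup>2"
      using N[OF that] form_completion_rules(2)[OF \<iota> E d d] by simp
    then show ?thesis
      using e form_completion_rules(1)[OF \<iota> E u u] by (simp add: power2_less_imp_less)
  qed
  then show "\<exists>N. \<forall>m\<ge>N. \<forall>n\<ge>N. norm (\<iota> (u m) - \<iota> (u n)) < e" by blast
qed

lemma form_completion_tendsto:
  fixes E :: "'a::hilbert_space \<rightharpoonup> real" and \<iota> :: "'a \<Rightarrow> 'c::hilbert_space"
  assumes \<iota>: "form_completion E \<iota>" and E: "positive_form E"
    and u: "\<And>n. u n \<in> dom E" and x: "x \<in> dom E" and lim: "(\<lambda>n. \<iota> (u n)) \<longlonglongrightarrow> \<iota> x"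
  shows "form_tendsto E u x"
proof -
  have "(\<lambda>n. (norm (\<iota> (u n) - \<iota> x))\<^sup>2) \<longlonglongrightarrow> (norm (\<iota> x - \<iota> x))\<^sup>2"
    by (intro tendsto_intros lim)
  moreover have "(norm (\<iota> (u n) - \<iota> x))\<^sup>2 = the (E (u n - x))" for n
  proof -
    have d: "u n - x \<in> dom E" by (rule dom_form_closed(3)[OF E u x])
    show ?thesis
      using form_completion_rules(1)[OF \<iota> E u x, of n] form_completion_rules(2)[OF \<iota> E d d] by simp
  qed
  ultimately show ?thesis unfolding form_tendsto_def using u x by simp
qed

text \<open>Because the image of the kernel is closed in the completion, the kernel is complete for \<open>E\<close>
  itself. So the projection \<open>P\<close> maps \<open>\<iota> u\<close> to \<open>\<iota> (u - k)\<close> for some \<open>k\<close> in the kernel, and the limit form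
  is again a quotient of \<open>E\<close>, with no reference to the completion.\<close>

lemma completion_quotient_form:
  fixes E :: "'a::hilbert_space \<rightharpoonup> real" and J :: "'a \<rightharpoonup> 'b::hilbert_space" and \<iota> :: "'a \<Rightarrow> 'c::hilbert_space"
  assumes E: "positive_form E" and J: "linear_operator J" and J_dom: "dom J \<subseteq> dom E"
    and sc: "scalars TYPE('b) = scalars TYPE('a)" and \<iota>: "form_completion E \<iota>"
    and ker: "closed (\<iota> ` null_space J)"
    and Q_dom: "dom Q = ran J"
    and Q: "\<forall>u\<in>dom J. Q (the (J u)) =
      Some ((norm (ortho_projection ip UNIV (ortho_complement ip UNIV (\<iota> ` null_space J)) (\<iota> u)))\<^sup>2)"
  shows "quotient_form E J Q"
  unfolding quotient_form_def
proof (intro conjI ballI Q_dom)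
  fix y assume y: "y \<in> ran J"
  let ?N = "null_space J"
  obtain u where Ju: "J u = Some y" using y unfolding ran_def by blast
  then have u: "u \<in> dom E" using J_dom by blast
  have N: "x \<in> dom E" if "x \<in> ?N" for x
    using subsetD[OF order_trans[OF null_space_subset J_dom] that] .
  have "\<exists>k\<in>?N. \<forall>v\<in>?N. polar E (u - k) v = 0"
  proof (rule orthogonal_decomposition[OF E subspaceK_null_space[OF J sc]])
    fix w assume w: "\<forall>n. w n \<in> ?N" "form_Cauchy E w"
    obtain z where z: "(\<lambda>n. \<iota> (w n)) \<longlonglongrightarrow> z"
      using form_completion_Cauchy[OF \<iota> E w(2)] Cauchy_convergent convergentD by blast
    have "z \<in> \<iota> ` ?N" by (rule closed_sequentially[OF ker _ z]) (use w(1) in blast)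
    then show "\<exists>x\<in>?N. form_tendsto E w x"
      using form_completion_tendsto[OF \<iota> E] N w(1) z by blast
  qed (use N u in blast)+
  then obtain k where k: "k \<in> ?N" "\<And>v. v \<in> ?N \<Longrightarrow> polar E (u - k) v = 0" by blast
  have uk: "u - k \<in> dom E" by (rule dom_form_closed(3)[OF E u N[OF k(1)]])
  have \<iota>uk: "\<iota> u - \<iota> k = \<iota> (u - k)" using form_completion_rules(1)[OF \<iota> E u N[OF k(1)]] by simp
  have "ortho_projection ip UNIV (ortho_complement ip UNIV (\<iota> ` ?N)) (\<iota> u) = \<iota> u - \<iota> k"
  proof (rule ortho_projection_eq[OF symmetric_sesquilinear_ip])
    show "subspaceK (UNIV :: 'c set)" unfolding subspaceK_def by simp
    show "x = 0" if "ip x x = 0" for x :: 'c using that by (simp add: ip_self)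
    show "ip (\<iota> u - \<iota> k) v = 0" if "v \<in> \<iota> ` ?N" for v
      unfolding \<iota>uk using that k(2) form_completion_rules(3)[OF \<iota> E uk N] by auto
  qed (use k(1) in auto)
  then have "(norm (ortho_projection ip UNIV (ortho_complement ip UNIV (\<iota> ` ?N)) (\<iota> u)))\<^sup>2 = the (E (u - k))"
    using \<iota>uk form_completion_rules(2)[OF \<iota> E uk uk] by simp
  moreover have "Q y = Some ((norm (ortho_projection ip UNIV (ortho_complement ip UNIV (\<iota> ` ?N)) (\<iota> u)))\<^sup>2)"
    using Q Ju by force
  moreover have "minimal_representative E J y (u - k)"
    using linear_operator_rules(2)[OF J Ju, of k 0] k unfolding minimal_representative_def null_space_def by simp
  ultimately show "\<exists>u. minimal_representative E J y u \<and> Q y = Some (the (E u))" by auto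
qed

theorem proposition3p1:
  fixes E :: "'h::hilbert_space \<rightharpoonup> real"
    and J :: "'h \<rightharpoonup> 'aux::hilbert_space"
    and \<iota> :: "'h \<Rightarrow> 'e::hilbert_space"
    and P :: "'e \<Rightarrow> 'e"
    and Q T :: "'aux \<rightharpoonup> real"
  assumes same_scalars: "scalars TYPE('aux) = scalars TYPE('h)"
    and E_closed: "closed_form E"
    and J_linear: "linear_operator J"
    and J_dom: "dom J \<subseteq> dom E"
    and J_dense: "closure (ran J) = UNIV"
    and J_closed: "closed_operator_wrt (form_plus E 1) J"
    and E_scalar_product: "\<forall>u\<in>dom E. the (E u) = 0 \<longrightarrow> u = 0"
    and completion: "form_completion E \<iota>"
    and kernel_closed: "closed (\<iota> ` null_space J)"
    and P: "P = ortho_projection ip UNIV (ortho_complement ip UNIV (\<iota> ` null_space J))"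
    and Q_dom: "dom Q = ran J"
    and Q: "\<forall>u\<in>dom J. Q (the (J u)) = Some ((norm (P (\<iota> u)))\<^sup>2)"
  shows "(is_trace E J T \<longleftrightarrow> T = form_closure (regular_part Q)) \<and>
         (closed ((\<lambda>u. (\<iota> u, the (J u))) ` dom J) \<longrightarrow> (is_trace E J T \<longleftrightarrow> T = Q))"
proof -
  note E = positive_if_closed[OF E_closed]
  have Q_quot: "quotient_form E J Q"
    using completion_quotient_form[OF E J_linear J_dom same_scalars completion kernel_closed Q_dom] Q P
    by blast
  have Q_pos: "positive_form Q"
    by (rule quotient_form_positive[OF E J_linear J_dom Q_quot same_scalars])
  have Q_dense: "closure (dom Q) = UNIV" using Q_dom J_dense by simp
  let ?T = "relaxation Q"
  have T: "closed_form ?T" "closure (dom ?T) = UNIV"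
    using relaxation_closed[OF Q_pos] dense_dom_relaxation[OF Q_pos Q_dense] by blast+
  have approx: "quotient_form (form_plus E a) J (trace_approx E J a)" if "0 < a" for a
    by (rule trace_approx_quotient_form[OF E_closed J_linear J_dom J_closed same_scalars that])
  have resolvents: "((\<lambda>a. inverse_plus_one (form_operator (trace_approx E J a)) f)
      \<longlongrightarrow> inverse_plus_one (form_operator ?T) f) (at_right 0)" for f
  proof (rule resolvent_convergence_from_above[OF Q_pos Q_dense])
    have "\<forall>\<^sub>F a in at_right (0::real). 0 < a" by (rule eventually_at_right_less)
    then show "\<forall>\<^sub>F a in at_right 0. closed_form (trace_approx E J a) \<and> dom (trace_approx E J a) = dom Q \<and>
        (\<forall>y\<in>dom Q. the (Q y) \<le> the (trace_approx E J a y))"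
    proof eventually_elim
      case (elim a)
      have "closed_form (trace_approx E J a)"
        by (rule quotient_form_closed[OF _ J_linear _ approx[OF elim] same_scalars
              closed_operator_limit[OF E_closed J_closed elim]])
          (use form_plus_positive[OF E] elim J_dom in simp_all)
      then show ?case
        using quotient_form_shift_limit(1)[OF E J_linear J_dom Q_quot approx _ elim] approx[OF elim] Q_dom
        unfolding quotient_form_def by simp
    qed
    show "((\<lambda>a. the (trace_approx E J a y)) \<longlongrightarrow> the (Q y)) (at_right 0)" if "y \<in> dom Q" for y
      using quotient_form_shift_limit(2)[OF E J_linear J_dom Q_quot approx] that Q_dom by simp
  qed
  have trace_iff: "is_trace E J T \<longleftrightarrow> T = ?T"
  proof
    assume "T = ?T"
    then show "is_trace E J T"
      unfolding is_trace_def using form_operator_positive_selfadjoint[OF T] resolvents T by blast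
  next
    assume "is_trace E J T"
    then have lim: "\<And>f. ((\<lambda>a. inverse_plus_one (form_operator (trace_approx E J a)) f)
        \<longlongrightarrow> inverse_plus_one (form_operator T) f) (at_right 0)"
      and cl: "closed_form T" "closure (dom T) = UNIV"
      unfolding is_trace_def by blast+
    show "T = ?T"
      by (rule closed_form_eq_if_resolvent_eq[OF cl T])
        (rule tendsto_unique[OF trivial_limit_at_right_real lim resolvents])
  qed
  moreover have "?T = Q" if graph: "closed ((\<lambda>u. (\<iota> u, the (J u))) ` dom J)"
  proof (rule relaxation_of_closed, rule quotient_form_closed[OF E J_linear J_dom Q_quot same_scalars])
    fix u y assume u: "\<forall>n. u n \<in> dom J" "form_Cauchy E u" and Ju: "(\<lambda>n. the (J (u n))) \<longlonglongrightarrow> y"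
    obtain z where z: "(\<lambda>n. \<iota> (u n)) \<longlonglongrightarrow> z"
      using form_completion_Cauchy[OF completion E u(2)] Cauchy_convergent convergentD by blast
    have "(z, y) \<in> (\<lambda>u. (\<iota> u, the (J u))) ` dom J"
      by (rule closed_sequentially[OF graph _ tendsto_Pair[OF z Ju]]) (use u(1) in blast)
    then obtain x where x: "x \<in> dom J" "z = \<iota> x" "y = the (J x)" by blast
    then have "form_tendsto E u x"
      using form_completion_tendsto[OF completion E] u(1) J_dom z by blast
    then show "\<exists>x. J x = Some y \<and> form_tendsto E u x" using x by auto
  qed
  ultimately show ?thesis
    using form_closure_regular_part[OF Q_pos Q_dense] by auto
qed

end
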